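(* Let $\mathbf{T}:\mathbb{Z}^d\curvearrowright(X,\mu)$ be a Følner rank one action, with stacking towers $\{\mathcal{T}_n\}$ of shapes $\{F_n\}$ ($\{F_n\}$ a Følner sequence) fixed and descendant sets $I_{m,n}$ defined from these towers. Let $\sigma_{\mathfrak{G}}:\mathbb{Z}^d\curvearrowright(X_{\mathfrak{G}},\mu_{\mathfrak{G}})$ be the $\mathbb{Z}^d$-odometer corresponding to a decreasing sequence $\mathfrak{G}=\{G_1,G_2,G_3,\ldots\}$ of finite-index subgroups of $\mathbb{Z}^d$. Then the following are equivalent: (1) $(X,\mu,\mathbf{T})$ factors onto $(X_{\mathfrak{G}},\mu_{\mathfrak{G}},\sigma_{\mathfrak{G}})$. (2) For each $j$ and every $\epsilon>0$ there exists $N\in\mathbb{N}$ such that for all $n\ge m\ge N$ there is $\mathbf{g}\in\mathbb{Z}^d$ such that $$\frac{\#(\{\mathbf{i}\in I_{m,n}:\mathbf{i}\not\equiv\mathbf{g}\bmod G_j\})}{\#(I_{m,n})}<\epsilon.$$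
   Context: Measure-preserving $\mathbb{Z}^d$-action $\mathbf{T}:\mathbb{Z}^d\curvearrowright(X,\mu)$: $(X,\mathcal{X},\mu)$ is a (non-atomic) Lebesgue probability space, or a finite set with normalized counting measure; for each $\mathbf{v}\in\mathbb{Z}^d$, $\mathbf{T}^{\mathbf{v}}:X\to X$ is an invertible measurable measure-preserving map, with $\mathbf{T}^{\mathbf{v}+\mathbf{w}}=\mathbf{T}^{\mathbf{v}}\circ\mathbf{T}^{\mathbf{w}}$ and $\mathbf{T}^{\mathbf{0}}=\mathrm{id}$. $(X,\mu,\mathbf{T})$ factors onto $(Y,\nu,\mathbf{S})$ if there is a measurable $\phi:X\to Y$ (a factor map) whose push-forward of $\mu$ is $\nu$ and with $\phi(\mathbf{T}^{\mathbf{v}}(x))=\mathbf{S}^{\mathbf{v}}(\phi(x))$ for a.e. $x$ and every $\mathbf{v}$. Odometers: for a decreasing sequence $\mathfrak{G}=\{G_j\}_{j\ge1}$ of finite-index subgroups of $\mathbb{Z}^d$, with quotient maps $q_j:\mathbb{Z}^d/G_{j+1}\to\mathbb{Z}^d/G_j$, $X_{\mathfrak{G}}=\{(\mathbf{x}_1,\mathbf{x}_2,\ldots):\mathbf{x}_j\in\mathbb{Z}^d/G_j,\ q_j(\mathbf{x}_{j+1})=\mathbf{x}_j\text{ for all }j\}$ (inverse limit, a compact topological group), $\sigma_{\mathfrak{G}}^{\mathbf{v}}(\mathbf{x}_1,\mathbf{x}_2,\ldots)=(\mathbf{x}_1+\mathbf{v}+G_1,\mathbf{x}_2+\mathbf{v}+G_2,\ldots)$,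 and $\mu_{\mathfrak{G}}$ is Haar probability measure (the unique invariant Borel probability measure). A shape is a nonempty finite subset of $\mathbb{Z}^d$. A sequence of shapes $\{F_n\}$ is a Følner sequence if $\#(F_n\triangle(F_n+\mathbf{v}))/\#(F_n)\to0$ for every $\mathbf{v}\in\mathbb{Z}^d$. A $\mathbf{T}$-tower of shape $R$ with base $B$ (measurable, $\mu(B)>0$) consists of the pairwise disjoint sets $\mathbf{T}^{\mathbf{v}}(B)$, $\mathbf{v}\in R$ (the levels), together with the error set $E=X\setminus\bigcup_{\mathbf{v}\in R}\mathbf{T}^{\mathbf{v}}(B)$. $\mathbf{T}$ is rank one for $\{F_n\}$ if there are $\mathbf{T}$-towers $\mathcal{T}_n$ of shape $F_n$ such that for every measurable $A$ there are sets $L_n$, each a union of levels of $\mathcal{T}_n$, with $\mu(L_n\triangle A)\to0$. $\mathbf{T}$ is Følner rank one if it is rank one for some Følner sequence $\{F_n\}$. The towers are stacking if for every $n$ each level of $\mathcal{T}_n$ is a union of levels of $\mathcal{T}_{n+1}$ and the error sets satisfy $E_{n+1}\subseteq E_n$. It is known that for a Følner rank one action (with $\mathbf{0}\in F_n$ for all $n$) the towers, of shapes $F_n$, can be chosen to be stacking and still such that for every measurable $A$ there are sets $L_n$, each a union of levels of $\mathcal{T}_n$, with $\mu(L_n\triangle A)\to0$; throughout, such towers $\mathcal{T}_n$, with bases $B_n$ and shapes $F_n\ni\mathbf{0}$, are fixed. For $n\ge m$, the descendant set is $I_{m,n}=\{\mathbf{i}\in F_n:\mathbf{T}^{\mathbf{i}}(B_n)\subseteq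 B_m\}$. *)

theory Defs
  imports "HOL-Probability.Probability_Measure" "HOL-Algebra.Product_Groups"
begin

text \<open>\<open>\<int>\<^sup>d\<close> is the type \<^typ>\<open>int ^ 'd\<close>, with \<open>d\<close> the cardinality of the finite type \<open>'d\<close>.\<close>

definition isomorphic_mod_null :: "'a measure \<Rightarrow> 'b measure \<Rightarrow> bool" where
  "isomorphic_mod_null M N \<longleftrightarrow>
     (\<exists>Z \<in> null_sets M. \<exists>W \<in> null_sets N. \<exists>f g.
        f \<in> measurable (restrict_space M (space M - Z)) (restrict_space N (space N - W)) \<and>
        g \<in> measurable (restrict_space N (space N - W)) (restrict_space M (space M - Z)) \<and>
        (\<forall>x \<in> space M - Z. g (f x) = x) \<and>
        (\<forall>y \<in> space N - W. f (g y) = y) \<and>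
        distr (restrict_space M (space M - Z)) (restrict_space N (space N - W)) f
          = restrict_space N (space N - W))"

text \<open>Lebesgue space in the sense of Rokhlin: complete, and isomorphic modulo null sets to
  the unit interval with Lebesgue measure (on the Lebesgue measurable sets).\<close>

definition nonatomic_lebesgue_prob_space :: "'a measure \<Rightarrow> bool" where
  "nonatomic_lebesgue_prob_space M \<longleftrightarrow>
     prob_space M \<and> complete_measure M \<and>
     isomorphic_mod_null M (lebesgue_on {0..1::real})"

definition finite_uniform_prob_space :: "'a measure \<Rightarrow> bool" where
  "finite_uniform_prob_space M \<longleftrightarrow>
     finite (space M) \<and> space M \<noteq> {} \<and> M = uniform_count_measure (space M)"

definition measure_preserving_action :: "'a measure \<Rightarrow> (int ^ 'd \<Rightarrow> 'a \<Rightarrow> 'a) \<Rightarrow> bool" where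
  "measure_preserving_action M T \<longleftrightarrow>
     (nonatomic_lebesgue_prob_space M \<or> finite_uniform_prob_space M) \<and>
     (\<forall>v. bij_betw (T v) (space M) (space M) \<and> T v \<in> measurable M M \<and> distr M M (T v) = M) \<and>
     (\<forall>v w. \<forall>x \<in> space M. T (v + w) x = T v (T w x)) \<and>
     (\<forall>x \<in> space M. T 0 x = x)"

definition factors_onto ::
    "'a measure \<Rightarrow> (int ^ 'd \<Rightarrow> 'a \<Rightarrow> 'a) \<Rightarrow> 'b measure \<Rightarrow> (int ^ 'd \<Rightarrow> 'b \<Rightarrow> 'b) \<Rightarrow> bool" where
  "factors_onto M T N S \<longleftrightarrow>
     (\<exists>\<phi> \<in> measurable M N. distr M N \<phi> = N \<and> (AE x in M. \<forall>v. \<phi> (T v x) = S v (\<phi> x)))"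

definition zd_group :: "(int ^ 'd) monoid" where
  "zd_group = \<lparr>carrier = UNIV, monoid.mult = (+), one = 0\<rparr>"

definition decreasing_finite_index_subgroups :: "(nat \<Rightarrow> (int ^ 'd) set) \<Rightarrow> bool" where
  "decreasing_finite_index_subgroups G \<longleftrightarrow>
     (\<forall>j. subgroup (G j) zd_group \<and> finite (rcosets\<^bsub>zd_group\<^esub> (G j)) \<and> G (Suc j) \<subseteq> G j)"

text \<open>An element \<open>x j\<close> of \<open>\<int>\<^sup>d / G j\<close> is a coset, i.e. a subset of \<open>\<int>\<^sup>d\<close>. The quotient map
  \<open>\<int>\<^sup>d / G (j+1) \<rightarrow> \<int>\<^sup>d / G j\<close> sends the coset \<open>C\<close> to \<open>G j + C\<close>.\<close>

definition odometer_points :: "(nat \<Rightarrow> (int ^ 'd) set) \<Rightarrow> (nat \<Rightarrow> (int ^ 'd) set) set" where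
  "odometer_points G =
     {x. \<forall>j. x j \<in> carrier (zd_group Mod G j) \<and> G j <#>\<^bsub>zd_group\<^esub> x (Suc j) = x j}"

definition odometer_group :: "(nat \<Rightarrow> (int ^ 'd) set) \<Rightarrow> (nat \<Rightarrow> (int ^ 'd) set) monoid" where
  "odometer_group G =
     (product_group UNIV (\<lambda>j. zd_group Mod G j))\<lparr>carrier := odometer_points G\<rparr>"

definition odometer_topology :: "(nat \<Rightarrow> (int ^ 'd) set) \<Rightarrow> (nat \<Rightarrow> (int ^ 'd) set) topology" where
  "odometer_topology G =
     subtopology
       (product_topology (\<lambda>j. discrete_topology (carrier (zd_group Mod G j))) UNIV)
       (odometer_points G)"

definition is_haar_prob_measure :: "'x monoid \<Rightarrow> 'x topology \<Rightarrow> 'x measure \<Rightarrow> bool" where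
  "is_haar_prob_measure H \<T> \<mu> \<longleftrightarrow>
     space \<mu> = topspace \<T> \<and>
     sets \<mu> = sigma_sets (topspace \<T>) {U. openin \<T> U} \<and>
     prob_space \<mu> \<and>
     (\<forall>a \<in> carrier H. distr \<mu> \<mu> (\<lambda>x. a \<otimes>\<^bsub>H\<^esub> x) = \<mu>)"

text \<open>\<open>THE\<close> is well defined: the points of the odometer form a compact metrizable group.\<close>

definition odometer_measure :: "(nat \<Rightarrow> (int ^ 'd) set) \<Rightarrow> (nat \<Rightarrow> (int ^ 'd) set) measure" where
  "odometer_measure G =
     (THE \<mu>. is_haar_prob_measure (odometer_group G) (odometer_topology G) \<mu>)"

definition odometer_action ::
    "int ^ 'd \<Rightarrow> (nat \<Rightarrow> (int ^ 'd) set) \<Rightarrow> (nat \<Rightarrow> (int ^ 'd) set)" where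
  "odometer_action v x = (\<lambda>j. x j #>\<^bsub>zd_group\<^esub> v)"

definition folner_sequence :: "(nat \<Rightarrow> (int ^ 'd) set) \<Rightarrow> bool" where
  "folner_sequence F \<longleftrightarrow>
     (\<forall>n. finite (F n) \<and> F n \<noteq> {}) \<and>
     (\<forall>v. (\<lambda>n. real (card (sym_diff (F n) ((\<lambda>u. u + v) ` F n))) / real (card (F n)))
            \<longlonglongrightarrow> 0)"

definition is_tower ::
    "'a measure \<Rightarrow> (int ^ 'd \<Rightarrow> 'a \<Rightarrow> 'a) \<Rightarrow> (int ^ 'd) set \<Rightarrow> 'a set \<Rightarrow> bool" where
  "is_tower M T R B \<longleftrightarrow>
     B \<in> sets M \<and> measure M B > 0 \<and> disjoint_family_on (\<lambda>v. T v ` B) R"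

definition tower_levels :: "(int ^ 'd \<Rightarrow> 'a \<Rightarrow> 'a) \<Rightarrow> (int ^ 'd) set \<Rightarrow> 'a set \<Rightarrow> 'a set set" where
  "tower_levels T R B = (\<lambda>v. T v ` B) ` R"

definition tower_error ::
    "'a measure \<Rightarrow> (int ^ 'd \<Rightarrow> 'a \<Rightarrow> 'a) \<Rightarrow> (int ^ 'd) set \<Rightarrow> 'a set \<Rightarrow> 'a set" where
  "tower_error M T R B = space M - \<Union> (tower_levels T R B)"

definition union_of_levels ::
    "(int ^ 'd \<Rightarrow> 'a \<Rightarrow> 'a) \<Rightarrow> (int ^ 'd) set \<Rightarrow> 'a set \<Rightarrow> 'a set \<Rightarrow> bool" where
  "union_of_levels T R B L \<longleftrightarrow> (\<exists>\<L> \<subseteq> tower_levels T R B. L = \<Union> \<L>)"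

definition rank_one_towers ::
    "'a measure \<Rightarrow> (int ^ 'd \<Rightarrow> 'a \<Rightarrow> 'a) \<Rightarrow> (nat \<Rightarrow> (int ^ 'd) set) \<Rightarrow> (nat \<Rightarrow> 'a set) \<Rightarrow> bool" where
  "rank_one_towers M T F B \<longleftrightarrow>
     (\<forall>n. is_tower M T (F n) (B n)) \<and>
     (\<forall>A \<in> sets M. \<exists>L. (\<forall>n. union_of_levels T (F n) (B n) (L n)) \<and>
                       (\<lambda>n. measure M (sym_diff (L n) A)) \<longlonglongrightarrow> 0)"

definition folner_rank_one :: "'a measure \<Rightarrow> (int ^ 'd \<Rightarrow> 'a \<Rightarrow> 'a) \<Rightarrow> bool" where
  "folner_rank_one M T \<longleftrightarrow> (\<exists>F. folner_sequence F \<and> (\<exists>B. rank_one_towers M T F B))"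

definition stacking_towers ::
    "'a measure \<Rightarrow> (int ^ 'd \<Rightarrow> 'a \<Rightarrow> 'a) \<Rightarrow> (nat \<Rightarrow> (int ^ 'd) set) \<Rightarrow> (nat \<Rightarrow> 'a set) \<Rightarrow> bool" where
  "stacking_towers M T F B \<longleftrightarrow>
     (\<forall>n. (\<forall>A \<in> tower_levels T (F n) (B n). union_of_levels T (F (Suc n)) (B (Suc n)) A) \<and>
          tower_error M T (F (Suc n)) (B (Suc n)) \<subseteq> tower_error M T (F n) (B n))"

definition descendants ::
    "(int ^ 'd \<Rightarrow> 'a \<Rightarrow> 'a) \<Rightarrow> (nat \<Rightarrow> (int ^ 'd) set) \<Rightarrow> (nat \<Rightarrow> 'a set) \<Rightarrow> nat \<Rightarrow> nat
      \<Rightarrow> (int ^ 'd) set" where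
  "descendants T F B m n = {i \<in> F n. T i ` B n \<subseteq> B m}"

end

theory Submission
  imports Defs "HOL-Probability.Infinite_Product_Measure"
begin

text \<open>
  A factor map onto the odometer is a compatible family of equivariant maps \<open>X \<rightarrow> \<int>\<^sup>d / G j\<close>. Its
  push-forward of \<open>\<mu>\<close> then takes care of itself: invariance gives all cosets of \<open>G j\<close> the same mass,
  and the only probability measure on the odometer with this property for every \<open>j\<close> is Haar measure
  (\<open>haar_iff_cylinder_uniform\<close>, \<open>cylinder_uniform_unique\<close>, \<open>ex_cylinder_uniform\<close>).

  Suppose that there is a factor map. The set \<open>A\<close> of points whose \<open>j\<close>-th coordinate is \<open>G j\<close> has positive
  measure, and it is almost disjoint from \<open>T u A\<close> unless \<open>u \<in> G j\<close>. Levels of the towers approximate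
  \<open>A\<close>, so for large \<open>m\<close> some level of the \<open>m\<close>-th tower lies in \<open>A\<close> up to a small proportion of its
  measure (\<open>level_mostly_inside\<close>); hence every level of that tower is concentrated on a translate of
  \<open>A\<close>. For \<open>m \<le> n\<close> the base \<open>B m\<close> is the disjoint union of the levels \<open>T i (B n)\<close>, where \<open>i\<close> is a
  descendant. A descendant in the wrong class modulo \<open>G j\<close> is concentrated on a translate of
  \<open>A\<close> other than the one that carries \<open>B m\<close>, so its level lies mostly in the small remainder of
  \<open>B m\<close>, and there are few such descendants (\<open>desc_concentrated\<close>).

  For the converse, let the address of \<open>x\<close> in the \<open>n\<close>-th tower be the \<open>v \<in> F n\<close> with
  \<open>x \<in> T v (B n)\<close>. When \<open>n\<close> is large compared with \<open>m\<close>, the Folner property makes the difference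
  of the addresses of \<open>x\<close> in the towers \<open>n\<close> and \<open>m\<close> a descendant, except on a small set; if most
  descendants agree modulo \<open>G l\<close>, the addresses of most points differ by a constant modulo \<open>G l\<close>
  (\<open>measure_address_jump\<close>). Along a subsequence of the towers the exceptional sets are summable.
  After the constants have been subtracted, the Borel-Cantelli lemma makes the addresses of almost
  every point converge in the odometer. The limit is equivariant because, by the Folner property
  again, moving \<open>x\<close> by \<open>T w\<close> adds \<open>w\<close> to its address except near the boundary of the shape
  (\<open>factor_of_convergent_addresses\<close>).
\<close>

section \<open>Cosets of subgroups of the integer lattice\<close>

abbreviation zcoset :: "(int ^ 'd) set \<Rightarrow> int ^ 'd \<Rightarrow> (int ^ 'd) set" where
  "zcoset H v \<equiv> H #>\<^bsub>zd_group\<^esub> v"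

lemma
  shows zd_carrier: "carrier (zd_group :: (int ^ 'd) monoid) = UNIV"
    and zd_mult: "x \<otimes>\<^bsub>zd_group\<^esub> y = x + y"
    and zd_one: "\<one>\<^bsub>zd_group\<^esub> = 0"
  by (simp_all add: zd_group_def)

lemmas zd_simps = zd_carrier zd_mult zd_one

lemma group_zd_group: "group (zd_group :: (int ^ 'd) monoid)"
proof (rule groupI)
  fix x :: "int ^ 'd"
  show "\<exists>y\<in>carrier zd_group. y \<otimes>\<^bsub>zd_group\<^esub> x = \<one>\<^bsub>zd_group\<^esub>"
    by (auto simp: zd_group_def intro!: exI[of _ "- x"])
qed (auto simp: zd_group_def)

lemma inv_zd_group: "inv\<^bsub>zd_group\<^esub> (x :: int ^ 'd) = - x"
  by (rule group.inv_equality[OF group_zd_group]) (auto simp: zd_group_def)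

lemma
  assumes "subgroup H (zd_group :: (int ^ 'd) monoid)"
  shows zd_subgroup_zero: "0 \<in> H"
    and zd_subgroup_add: "\<And>x y. x \<in> H \<Longrightarrow> y \<in> H \<Longrightarrow> x + y \<in> H"
    and zd_subgroup_minus: "\<And>x. x \<in> H \<Longrightarrow> - x \<in> H"
  using subgroup.one_closed[OF assms] subgroup.m_closed[OF assms]
    subgroup.m_inv_closed[OF assms]
  by (auto simp: zd_simps inv_zd_group)

lemma zd_subgroup_diff:
  assumes "subgroup H (zd_group :: (int ^ 'd) monoid)" "x \<in> H" "y \<in> H"
  shows "x - y \<in> H"
  using zd_subgroup_add[OF assms(1,2) zd_subgroup_minus[OF assms(1,3)]] by simp

lemma mem_zcoset: "u \<in> zcoset H v \<longleftrightarrow> u - v \<in> H"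
  by (auto simp: r_coset_def zd_group_def) (metis diff_add_cancel)

lemma zcoset_eq_iff:
  assumes "subgroup H (zd_group :: (int ^ 'd) monoid)"
  shows "zcoset H v = zcoset H w \<longleftrightarrow> v - w \<in> H"
proof
  assume "zcoset H v = zcoset H w"
  moreover have "v \<in> zcoset H v" using zd_subgroup_zero[OF assms] by (simp add: mem_zcoset)
  ultimately show "v - w \<in> H" by (simp add: mem_zcoset)
next
  assume *: "v - w \<in> H"
  have "u - v \<in> H \<longleftrightarrow> u - w \<in> H" for u
    using zd_subgroup_add[OF assms _ *, of "u - v"] zd_subgroup_diff[OF assms _ *, of "u - w"]
    by auto
  then show "zcoset H v = zcoset H w"
    by (auto simp: mem_zcoset)
qed

lemma carrier_zd_quotient: "carrier (zd_group Mod H) = range (zcoset H)"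
  by (auto simp: FactGroup_def RCOSETS_def zd_group_def)

lemma zcoset_shift: "zcoset H v #>\<^bsub>zd_group\<^esub> w = zcoset H (v + w)"
  by (auto simp: mem_zcoset algebra_simps)

text \<open>For \<open>H = K\<close> this is the group law of \<open>\<int>\<^sup>d / K\<close>; for \<open>v = 0\<close> it is the quotient map
  \<open>\<int>\<^sup>d / H \<rightarrow> \<int>\<^sup>d / K\<close> between coordinates of the odometer.\<close>

lemma set_mult_zcoset:
  assumes K: "subgroup K (zd_group :: (int ^ 'd) monoid)" and H: "0 \<in> H" "H \<subseteq> K"
  shows "zcoset K v <#>\<^bsub>zd_group\<^esub> zcoset H w = zcoset K (v + w)"
proof safe
  fix u assume "u \<in> zcoset K v <#>\<^bsub>zd_group\<^esub> zcoset H w"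
  then obtain a b where "u = a + b" "a - v \<in> K" "b - w \<in> K"
    using H by (auto simp: set_mult_def mem_zcoset zd_simps)
  then show "u \<in> zcoset K (v + w)"
    using zd_subgroup_add[OF K, of "a - v" "b - w"] by (simp add: mem_zcoset algebra_simps)
next
  fix u assume "u \<in> zcoset K (v + w)"
  then have "u - w \<in> zcoset K v" "w \<in> zcoset H w" "u = (u - w) + w"
    using H by (auto simp: mem_zcoset algebra_simps)
  then show "u \<in> zcoset K v <#>\<^bsub>zd_group\<^esub> zcoset H w"
    unfolding set_mult_def zd_simps by blast
qed

section \<open>Haar measure on the odometer\<close>

locale zd_odometer =
  fixes G :: "nat \<Rightarrow> (int ^ 'd) set"
  assumes G: "decreasing_finite_index_subgroups G"
begin

lemma subgroup_G: "subgroup (G j) zd_group"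
  and finite_coset_range: "finite (range (zcoset (G j)))"
  using G unfolding carrier_zd_quotient[of "G j", symmetric]
  by (auto simp: decreasing_finite_index_subgroups_def FactGroup_def)

lemma G_antimono: "i \<le> j \<Longrightarrow> G j \<subseteq> G i"
  by (rule lift_Suc_antimono_le[of G i j]) (use G in \<open>simp_all add: decreasing_finite_index_subgroups_def\<close>)

lemmas G_zero = zd_subgroup_zero[OF subgroup_G]
  and G_add = zd_subgroup_add[OF subgroup_G]
  and G_diff = zd_subgroup_diff[OF subgroup_G]
  and G_minus = zd_subgroup_minus[OF subgroup_G]
  and G_zcoset_eq = zcoset_eq_iff[OF subgroup_G]

lemma zcoset_coarsen: "i \<le> j \<Longrightarrow> G i <#>\<^bsub>zd_group\<^esub> zcoset (G j) v = zcoset (G i) v"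
  using set_mult_zcoset[OF subgroup_G G_zero G_antimono, of i j 0 v]
  by (simp add: r_coset_def zd_group_def)

lemma odometer_pointsI:
  assumes "\<And>j. x j = zcoset (G j) (u j)" "\<And>j. u (Suc j) - u j \<in> G j"
  shows "x \<in> odometer_points G"
  using assms zcoset_coarsen[of j "Suc j" for j]
  by (auto simp: odometer_points_def carrier_zd_quotient G_zcoset_eq)

lemma odometer_points_rep: "x \<in> odometer_points G \<Longrightarrow> \<exists>u. x j = zcoset (G j) u"
  unfolding odometer_points_def carrier_zd_quotient by blast

lemma odometer_points_coarser:
  assumes x: "x \<in> odometer_points G" and "x j = zcoset (G j) u" "i \<le> j"
  shows "x i = zcoset (G i) u"
  using assms(3,2)
proof (induction i rule: inc_induct)
  case (step i)
  have "x i = G i <#>\<^bsub>zd_group\<^esub> x (Suc i)" using x unfolding odometer_points_def by blast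
  also have "\<dots> = zcoset (G i) u" using step zcoset_coarsen[of i "Suc i" u] by simp
  finally show ?case .
qed

definition cylinder :: "nat \<Rightarrow> int ^ 'd \<Rightarrow> (nat \<Rightarrow> (int ^ 'd) set) set" where
  "cylinder j v = {x \<in> odometer_points G. x j = zcoset (G j) v}"

lemma cylinder_subset: "i \<le> j \<Longrightarrow> x \<in> cylinder j v \<Longrightarrow> x \<in> cylinder i v"
  using odometer_points_coarser[of x j v i] by (simp add: cylinder_def)

lemma cylinder_eqI: "v - w \<in> G j \<Longrightarrow> cylinder j v = cylinder j w"
  unfolding cylinder_def using G_zcoset_eq[of j v w] by auto

text \<open>The empty set is included to make the family closed under intersection.\<close>

definition cylinders :: "(nat \<Rightarrow> (int ^ 'd) set) set set" where
  "cylinders = insert {} {cylinder j v |j v. True}"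

lemma cylinders_Pow: "cylinders \<subseteq> Pow (odometer_points G)"
  by (auto simp: cylinders_def cylinder_def)

lemma countable_cylinders: "countable cylinders"
proof -
  have "{cylinder j v |j v. True} = range (\<lambda>(j, v). cylinder j v)" by auto
  then show ?thesis unfolding cylinders_def by (metis countable_insert countableI_type countable_image)
qed

text \<open>Two cylinders are nested or disjoint.\<close>

lemma Int_stable_cylinders: "Int_stable cylinders"
proof -
  have *: "cylinder i v \<inter> cylinder j w \<in> cylinders" if "i \<le> j" for i j v w
  proof (cases "w - v \<in> G i")
    case True
    then have "cylinder j w \<subseteq> cylinder i v"
      using cylinder_subset[OF that, of _ w] cylinder_eqI[of w v i] by auto
    then have "cylinder i v \<inter> cylinder j w = cylinder j w" by auto
    then show ?thesis by (auto simp: cylinders_def)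
  next
    case False
    then have "cylinder i v \<inter> cylinder j w = {}"
      using cylinder_subset[OF that, of _ w] G_zcoset_eq[of i w v] by (auto simp: cylinder_def)
    then show ?thesis by (auto simp: cylinders_def)
  qed
  have "cylinder i v \<inter> cylinder j w \<in> cylinders" for i j v w
    using *[of i j v w] *[of j i w v] by (metis Int_commute nat_le_linear)
  moreover have "{} \<in> cylinders" by (simp add: cylinders_def)
  moreover have "C = {} \<or> (\<exists>i v. C = cylinder i v)" if "C \<in> cylinders" for C
    using that by (auto simp: cylinders_def)
  ultimately show ?thesis
    by (metis Int_stableI Int_empty_left Int_empty_right)
qed

lemma topspace_odometer: "topspace (odometer_topology G) = odometer_points G"
  by (auto simp: odometer_topology_def odometer_points_def)

lemma openin_cylinder: "openin (odometer_topology G) (cylinder j v)"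
proof -
  have "openin (product_topology (\<lambda>j. discrete_topology (carrier (zd_group Mod G j))) UNIV)
      (PiE UNIV (\<lambda>i. if i = j then {zcoset (G j) v} else carrier (zd_group Mod G i)))"
    by (subst openin_PiE_gen) (auto simp: carrier_zd_quotient)
  moreover have "cylinder j v =
      (PiE UNIV (\<lambda>i. if i = j then {zcoset (G j) v} else carrier (zd_group Mod G i)))
        \<inter> odometer_points G"
    by (auto simp: cylinder_def odometer_points_def PiE_def Pi_def split: if_splits)
  ultimately show ?thesis
    unfolding odometer_topology_def openin_subtopology by blast
qed

text \<open>By compatibility of the coordinates, a basic open set, which constrains finitely many of
  them, constrains only the last of these.\<close>

lemma openin_contains_cylinder:
  assumes "openin (odometer_topology G) U" "x \<in> U"
  shows "\<exists>j v. x \<in> cylinder j v \<and> cylinder j v \<subseteq> U"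
proof -
  obtain V where V: "openin (product_topology (\<lambda>j. discrete_topology (carrier (zd_group Mod G j))) UNIV) V"
    and U: "U = V \<inter> odometer_points G"
    using assms by (auto simp: odometer_topology_def openin_subtopology)
  obtain W where W: "finite {i. W i \<noteq> carrier (zd_group Mod G i)}" "x \<in> PiE UNIV W" "PiE UNIV W \<subseteq> V"
    using V assms(2) U by (auto simp: openin_product_topology_alt)
  obtain j where j: "\<And>i. W i \<noteq> carrier (zd_group Mod G i) \<Longrightarrow> i \<le> j"
    using W(1) finite_nat_set_iff_bounded_le by auto
  obtain v where v: "x j = zcoset (G j) v"
    using odometer_points_rep assms(2) U by blast
  have x: "x \<in> odometer_points G" using assms U by auto
  have "y \<in> PiE UNIV W" if y: "y \<in> cylinder j v" for y
  proof (clarsimp simp: PiE_iff)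
    fix i
    show "y i \<in> W i"
    proof (cases "W i = carrier (zd_group Mod G i)")
      case True
      then show ?thesis using y by (auto simp: cylinder_def odometer_points_def)
    next
      case False
      then have "y i = x i"
        using j[OF False] y odometer_points_coarser[OF x v] odometer_points_coarser[of y j v i]
        by (auto simp: cylinder_def)
      then show ?thesis using W(2) by auto
    qed
  qed
  then have "cylinder j v \<subseteq> V" using W(3) by blast
  then have "cylinder j v \<subseteq> U" using U by (auto simp: cylinder_def)
  moreover have "x \<in> cylinder j v" using x v by (auto simp: cylinder_def)
  ultimately show ?thesis by blast
qed

text \<open>There are only countably many cylinders, so the unions that form the open sets are countable.\<close>

lemma borel_eq_sigma_cylinders:
  "sigma_sets (odometer_points G) {U. openin (odometer_topology G) U}
     = sigma_sets (odometer_points G) cylinders"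
proof (rule sigma_sets_eqI)
  fix U assume "U \<in> {U. openin (odometer_topology G) U}"
  then have "\<exists>C\<in>cylinders. x \<in> C \<and> C \<subseteq> U" if "x \<in> U" for x
    using openin_contains_cylinder[of U x] that unfolding cylinders_def by blast
  then have U: "U = \<Union>{C \<in> cylinders. C \<subseteq> U}" by blast
  have "countable {C \<in> cylinders. C \<subseteq> U}"
    by (rule countable_subset[OF _ countable_cylinders]) auto
  then show "U \<in> sigma_sets (odometer_points G) cylinders"
    by (subst U, intro sigma_sets_UNION sigma_sets.Basic) auto
next
  fix C assume "C \<in> cylinders"
  then show "C \<in> sigma_sets (odometer_points G) {U. openin (odometer_topology G) U}"
    using openin_cylinder by (auto simp: cylinders_def)
qed

text \<open>Every measure argument on the odometer goes through this property: it is checked on cylinders, and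
  it amounts to being Haar measure.\<close>

definition cylinder_uniform :: "(nat \<Rightarrow> (int ^ 'd) set) measure \<Rightarrow> bool" where
  "cylinder_uniform \<mu> \<longleftrightarrow> space \<mu> = odometer_points G \<and>
     sets \<mu> = sigma_sets (odometer_points G) cylinders \<and> prob_space \<mu> \<and>
     (\<forall>j v w. measure \<mu> (cylinder j v) = measure \<mu> (cylinder j w))"

lemma
  assumes "cylinder_uniform \<mu>"
  shows cylinder_uniform_space: "space \<mu> = odometer_points G"
    and cylinder_uniform_sets: "sets \<mu> = sigma_sets (odometer_points G) cylinders"
    and cylinder_uniform_prob: "prob_space \<mu>"
  using assms unfolding cylinder_uniform_def by blast+

lemma cylinder_sets:
  assumes "sets \<mu> = sigma_sets (odometer_points G) cylinders"
  shows "cylinder j v \<in> sets \<mu>"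
  unfolding assms by (rule sigma_sets.Basic) (auto simp: cylinders_def)

lemma cylinder_uniform_measure:
  assumes \<mu>: "cylinder_uniform \<mu>"
  shows "measure \<mu> (cylinder j v) = 1 / card (range (zcoset (G j)))"
proof -
  interpret prob_space \<mu> by (rule cylinder_uniform_prob[OF \<mu>])
  let ?c = "\<lambda>C. {x \<in> odometer_points G. x j = C}"
  have "space \<mu> = (\<Union>C\<in>range (zcoset (G j)). ?c C)"
    unfolding cylinder_uniform_space[OF \<mu>]
  proof (intro equalityI subsetI)
    fix x assume x: "x \<in> odometer_points G"
    then obtain u where "x j = zcoset (G j) u" using odometer_points_rep by blast
    with x show "x \<in> (\<Union>C\<in>range (zcoset (G j)). ?c C)" by auto
  qed auto
  then have "1 = measure \<mu> (\<Union>C\<in>range (zcoset (G j)). ?c C)"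
    using prob_space by simp
  also have "\<dots> = (\<Sum>C\<in>range (zcoset (G j)). measure \<mu> (?c C))"
    using cylinder_sets[OF cylinder_uniform_sets[OF \<mu>], of j]
    by (intro finite_measure_finite_Union finite_coset_range)
       (auto simp: disjoint_family_on_def cylinder_def)
  also have "\<dots> = (\<Sum>C\<in>range (zcoset (G j)). measure \<mu> (cylinder j v))"
  proof (rule sum.cong)
    fix C assume "C \<in> range (zcoset (G j))"
    then obtain w where w: "C = zcoset (G j) w" by blast
    have "measure \<mu> (cylinder j w) = measure \<mu> (cylinder j v)"
      using \<mu> unfolding cylinder_uniform_def by blast
    then show "measure \<mu> (?c C) = measure \<mu> (cylinder j v)"
      by (simp only: w cylinder_def)
  qed simp
  finally have *: "1 = card (range (zcoset (G j))) * measure \<mu> (cylinder j v)" by simp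
  then have "card (range (zcoset (G j))) \<noteq> 0" by (intro notI) simp
  with * show ?thesis by (simp add: field_simps)
qed

text \<open>On each level the cylinders form a finite partition, so uniformity fixes the mass of each of them,
  and the cylinders are an intersection-stable generator.\<close>

lemma cylinder_uniform_unique:
  assumes \<mu>: "cylinder_uniform \<mu>" and \<nu>: "cylinder_uniform \<nu>"
  shows "\<mu> = \<nu>"
proof (rule measure_eqI_generator_eq_countable[OF Int_stable_cylinders cylinders_Pow])
  interpret M: prob_space \<mu> by (rule cylinder_uniform_prob[OF \<mu>])
  interpret N: prob_space \<nu> by (rule cylinder_uniform_prob[OF \<nu>])
  show "emeasure \<mu> X = emeasure \<nu> X" if "X \<in> cylinders" for X
    using that cylinder_uniform_measure[OF \<mu>] cylinder_uniform_measure[OF \<nu>]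
    by (auto simp: cylinders_def M.emeasure_eq_measure N.emeasure_eq_measure)
  show "emeasure \<mu> a \<noteq> \<infinity>" for a by simp
  show "\<Union> cylinders = odometer_points G"
  proof
    show "odometer_points G \<subseteq> \<Union> cylinders"
    proof
      fix x assume x: "x \<in> odometer_points G"
      then obtain v where "x \<in> cylinder 0 v" using odometer_points_rep[of x 0] by (auto simp: cylinder_def)
      then show "x \<in> \<Union> cylinders" by (auto simp: cylinders_def)
    qed
  qed (use cylinders_Pow in blast)
qed (fact cylinder_uniform_sets[OF \<mu>] cylinder_uniform_sets[OF \<nu>] subset_refl countable_cylinders)+

lemma odometer_mult:
  assumes "a \<in> odometer_points G" "x \<in> odometer_points G"
    "a j = zcoset (G j) u" "x j = zcoset (G j) v"
  shows "(a \<otimes>\<^bsub>odometer_group G\<^esub> x) j = zcoset (G j) (u + v)"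
  using assms set_mult_zcoset[OF subgroup_G G_zero, of j j u v]
  by (simp add: odometer_group_def product_group_def FactGroup_def)

lemma odometer_mult_closed:
  assumes "a \<in> odometer_points G" "x \<in> odometer_points G"
  shows "a \<otimes>\<^bsub>odometer_group G\<^esub> x \<in> odometer_points G"
proof -
  obtain u v where u: "\<And>j. a j = zcoset (G j) (u j)" and v: "\<And>j. x j = zcoset (G j) (v j)"
    using odometer_points_rep assms by metis
  have "zcoset (G j) (u (Suc j)) = zcoset (G j) (u j)" "zcoset (G j) (v (Suc j)) = zcoset (G j) (v j)" for j
    using odometer_points_coarser[of a "Suc j" "u (Suc j)" j]
      odometer_points_coarser[of x "Suc j" "v (Suc j)" j] u v assms by simp_all
  then have "u (Suc j) - u j + (v (Suc j) - v j) \<in> G j" for j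
    by (simp add: G_zcoset_eq G_add)
  then show ?thesis
    using odometer_mult[OF assms u v]
    by (intro odometer_pointsI[where u = "\<lambda>j. u j + v j"]) (auto simp: algebra_simps)
qed

lemma odometer_mult_vimage_cylinder:
  assumes a: "a \<in> odometer_points G" "a j = zcoset (G j) u"
  shows "(\<lambda>x. a \<otimes>\<^bsub>odometer_group G\<^esub> x) -` cylinder j v \<inter> odometer_points G = cylinder j (v - u)"
proof -
  have "a \<otimes>\<^bsub>odometer_group G\<^esub> x \<in> cylinder j v \<longleftrightarrow> x \<in> cylinder j (v - u)"
    if x: "x \<in> odometer_points G" for x
  proof -
    obtain w where w: "x j = zcoset (G j) w" using odometer_points_rep x by blast
    show ?thesis
      using odometer_mult[OF a(1) x a(2) w] odometer_mult_closed[OF a(1) x] x w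
      by (simp add: cylinder_def G_zcoset_eq algebra_simps)
  qed
  then show ?thesis by (auto simp: cylinder_def)
qed

lemma measurable_odometer_mult:
  assumes a: "a \<in> odometer_points G" and se: "sets \<mu> = sigma_sets (odometer_points G) cylinders"
  shows "(\<lambda>x. a \<otimes>\<^bsub>odometer_group G\<^esub> x) \<in> measurable \<mu> \<mu>"
proof (rule measurable_sigma_sets[OF se cylinders_Pow])
  have sp: "space \<mu> = odometer_points G"
    using sets_eq_imp_space_eq[of \<mu> "sigma (odometer_points G) cylinders"] se cylinders_Pow
    by (simp add: space_measure_of_conv sets_measure_of)
  show "(\<lambda>x. a \<otimes>\<^bsub>odometer_group G\<^esub> x) \<in> space \<mu> \<rightarrow> odometer_points G"
    using odometer_mult_closed[OF a] sp by auto
  fix C assume "C \<in> cylinders"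
  then consider "C = {}" | j v where "C = cylinder j v" by (auto simp: cylinders_def)
  then show "(\<lambda>x. a \<otimes>\<^bsub>odometer_group G\<^esub> x) -` C \<inter> space \<mu> \<in> sets \<mu>"
  proof cases
    case (2 j v)
    obtain u where "a j = zcoset (G j) u" using odometer_points_rep[OF a] by blast
    then show ?thesis
      unfolding sp 2 using odometer_mult_vimage_cylinder[OF a] cylinder_sets[OF se] by simp
  qed simp
qed

text \<open>Translations permute the cylinders of each level transitively, so an invariant measure is uniform on
  them. Conversely a translate of a uniform measure is uniform, hence equal to it by uniqueness.\<close>

lemma haar_iff_cylinder_uniform:
  "is_haar_prob_measure (odometer_group G) (odometer_topology G) \<mu> \<longleftrightarrow> cylinder_uniform \<mu>"
proof -
  define good where "good \<longleftrightarrow> space \<mu> = odometer_points G \<and>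
    sets \<mu> = sigma_sets (odometer_points G) cylinders \<and> prob_space \<mu>"
  have translate: "measure (distr \<mu> \<mu> (\<lambda>x. a \<otimes>\<^bsub>odometer_group G\<^esub> x)) (cylinder j v) =
      measure \<mu> (cylinder j (v - u))"
    if "good" and a: "a \<in> odometer_points G" "a j = zcoset (G j) u" for a j u v
    using \<open>good\<close> odometer_mult_vimage_cylinder[OF a] measurable_odometer_mult[OF a(1)] cylinder_sets[of \<mu>]
    by (subst measure_distr) (simp_all add: good_def)
  show ?thesis
  proof
    assume h: "is_haar_prob_measure (odometer_group G) (odometer_topology G) \<mu>"
    then have good: good
      unfolding is_haar_prob_measure_def topspace_odometer borel_eq_sigma_cylinders good_def by blast
    have "measure \<mu> (cylinder j v) = measure \<mu> (cylinder j w)" for j v w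
    proof -
      define a where "a = (\<lambda>i. zcoset (G i) (v - w))"
      have a: "a \<in> odometer_points G"
        by (rule odometer_pointsI[where u = "\<lambda>_. v - w"]) (simp_all add: a_def G_zero)
      have "distr \<mu> \<mu> (\<lambda>x. a \<otimes>\<^bsub>odometer_group G\<^esub> x) = \<mu>"
        using h a by (simp add: is_haar_prob_measure_def odometer_group_def)
      then show ?thesis
        using translate[OF good a, of j "v - w" v] by (simp add: a_def)
    qed
    with good show "cylinder_uniform \<mu>"
      unfolding cylinder_uniform_def good_def by blast
  next
    assume u: "cylinder_uniform \<mu>"
    then have good: good by (simp add: cylinder_uniform_def good_def)
    interpret prob_space \<mu> by (rule cylinder_uniform_prob[OF u])
    have "distr \<mu> \<mu> (\<lambda>x. a \<otimes>\<^bsub>odometer_group G\<^esub> x) = \<mu>" if a: "a \<in> odometer_points G" for a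
    proof -
      have "measure (distr \<mu> \<mu> (\<lambda>x. a \<otimes>\<^bsub>odometer_group G\<^esub> x)) (cylinder j v) =
          1 / card (range (zcoset (G j)))" for j v
        using odometer_points_rep[OF a, of j] translate[OF good a] cylinder_uniform_measure[OF u]
        by metis
      then have "cylinder_uniform (distr \<mu> \<mu> (\<lambda>x. a \<otimes>\<^bsub>odometer_group G\<^esub> x))"
        unfolding cylinder_uniform_def
        using good prob_space_distr[OF measurable_odometer_mult[OF a]] by (simp add: good_def)
      then show ?thesis using cylinder_uniform_unique u by blast
    qed
    with good show "is_haar_prob_measure (odometer_group G) (odometer_topology G) \<mu>"
      unfolding is_haar_prob_measure_def topspace_odometer borel_eq_sigma_cylinders good_def
      by (simp add: odometer_group_def)
  qed
qed

text \<open>Haar measure is the law of \<open>\<omega> 0 + \<dots> + \<omega> j + G j\<close>, where \<open>\<omega> i\<close> are independent and \<open>\<omega> i\<close> is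
  uniform on a transversal \<open>D i\<close> of \<open>G i\<close> in \<open>G (i - 1)\<close> (in \<open>\<int>\<^sup>d\<close> for \<open>i = 0\<close>). Each coset of
  \<open>G j\<close> is hit by exactly one choice of the first \<open>j + 1\<close> digits, so all of its cosets are equally
  likely.\<close>

lemma ex_cylinder_uniform: "\<exists>\<mu>. cylinder_uniform \<mu>"
proof -
  define K where "K = (\<lambda>i. case i of 0 \<Rightarrow> UNIV | Suc j \<Rightarrow> G j)"
  have K_Suc: "K (Suc i) = G i" and K_0: "K 0 = UNIV" for i by (simp_all add: K_def)
  have K_zero: "0 \<in> K i" for i
    by (cases i) (simp_all add: K_Suc K_0 G_zero)
  have K_add: "x + y \<in> K i" if "x \<in> K i" "y \<in> K i" for i x y
    using that by (cases i) (simp_all add: K_Suc K_0 G_add)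
  have K_dec: "x \<in> K i" if "x \<in> G i" for i x
    using that G_antimono[of "i - 1" i] by (cases i) (auto simp: K_Suc K_0)
  define rep where "rep = (\<lambda>C :: (int ^ 'd) set. SOME d. d \<in> C)"
  define D where "D = (\<lambda>i. rep ` zcoset (G i) ` K i)"
  have rep: "rep (zcoset (G i) v) - v \<in> G i" for i v
  proof -
    have "v \<in> zcoset (G i) v" by (simp add: mem_zcoset G_zero)
    then have "rep (zcoset (G i) v) \<in> zcoset (G i) v" unfolding rep_def by (rule someI)
    then show ?thesis by (simp add: mem_zcoset)
  qed
  have D_fin: "finite (D i)" for i
    unfolding D_def
    by (rule finite_imageI, rule finite_subset[OF _ finite_coset_range[of i]]) (rule image_mono, simp)
  have D_nonempty: "D i \<noteq> {}" for i
    using K_zero by (auto simp: D_def)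
  have D_K: "d \<in> K i" if d: "d \<in> D i" for i d
  proof -
    obtain v where v: "v \<in> K i" "d = rep (zcoset (G i) v)" using d by (auto simp: D_def)
    then show ?thesis using K_add[OF K_dec[OF rep] v(1), of v] by simp
  qed
  have D_ex: "\<exists>d\<in>D i. v - d \<in> G i" if "v \<in> K i" for i v
    using that G_minus[OF rep[of i v]] by (intro bexI[of _ "rep (zcoset (G i) v)"]) (auto simp: D_def)
  have D_unique: "d = d'" if d: "d \<in> D i" "d' \<in> D i" and "v - d \<in> G i" "v - d' \<in> G i" for i v d d'
  proof -
    obtain u u' where u: "d = rep (zcoset (G i) u)" "d' = rep (zcoset (G i) u')"
      using d by (auto simp: D_def)
    have "d - d' \<in> G i" using G_diff[OF that(4,3)] by simp
    moreover have "d - u \<in> G i" "d' - u' \<in> G i" using rep u by auto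
    ultimately have "zcoset (G i) u = zcoset (G i) u'" by (metis G_zcoset_eq)
    then show ?thesis using u by simp
  qed
  \<comment> \<open>The digits of a coset of \<open>K n\<close> are found from first to last: the later digits lie in \<open>K n\<close>, so
    the first \<open>n\<close> of them are fixed by the coset modulo \<open>K n\<close> alone.\<close>
  have digits: "\<exists>a. (\<forall>i<n. a i \<in> D i) \<and> v - (\<Sum>i<n. a i) \<in> K n \<and>
      (\<forall>\<omega>. (\<forall>i. \<omega> i \<in> D i) \<longrightarrow> v - (\<Sum>i<n. \<omega> i) \<in> K n \<longrightarrow> (\<forall>i<n. \<omega> i = a i))" for n v
  proof (induction n)
    case 0
    then show ?case by (simp add: K_0)
  next
    case (Suc n)
    then obtain a where a: "\<forall>i<n. a i \<in> D i" "v - (\<Sum>i<n. a i) \<in> K n"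
      and uniq: "\<And>\<omega>. (\<forall>i. \<omega> i \<in> D i) \<Longrightarrow> v - (\<Sum>i<n. \<omega> i) \<in> K n \<Longrightarrow> \<forall>i<n. \<omega> i = a i"
      by blast
    obtain d where d: "d \<in> D n" "v - (\<Sum>i<n. a i) - d \<in> G n" using D_ex[OF a(2)] by blast
    show ?case
    proof (intro exI[of _ "a(n := d)"] conjI allI impI)
      show "(a(n := d)) i \<in> D i" if "i < Suc n" for i using that a(1) d(1) by auto
      have "(\<Sum>i<n. (a(n := d)) i) = (\<Sum>i<n. a i)" by (intro sum.cong) auto
      then show "v - (\<Sum>i<Suc n. (a(n := d)) i) \<in> K (Suc n)"
        using d(2) by (simp add: K_Suc diff_diff_eq)
      fix \<omega> i assume \<omega>: "\<forall>i. \<omega> i \<in> D i" "v - (\<Sum>i<Suc n. \<omega> i) \<in> K (Suc n)" "i < Suc n"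
      have last: "v - (\<Sum>i<n. \<omega> i) - \<omega> n \<in> G n" using \<omega>(2) by (simp add: K_Suc diff_diff_eq)
      then have "v - (\<Sum>i<n. \<omega> i) \<in> K n"
        using K_add[OF K_dec[OF last] D_K[of "\<omega> n" n]] \<omega>(1) by simp
      then have eq: "\<forall>i<n. \<omega> i = a i" by (rule uniq[OF \<omega>(1)])
      then have "(\<Sum>i<n. \<omega> i) = (\<Sum>i<n. a i)" by (intro sum.cong) auto
      with last have "\<omega> n = d" using D_unique[OF _ d(1) _ d(2)] \<omega>(1) by simp
      then show "\<omega> i = (a(n := d)) i" using eq \<omega>(3) by (auto simp: less_Suc_eq)
    qed
  qed
  define U where "U = (\<lambda>i. uniform_count_measure (D i))"
  interpret product_prob_space U UNIV
    by (auto simp: product_prob_space_def product_sigma_finite_def product_prob_space_axioms_def U_def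
        intro!: prob_space_imp_sigma_finite prob_space_uniform_count_measure D_fin D_nonempty)
  define P where "P = PiM UNIV U"
  have spP: "\<omega> \<in> space P \<longleftrightarrow> (\<forall>i. \<omega> i \<in> D i)" for \<omega>
    by (auto simp: P_def space_PiM U_def space_uniform_count_measure PiE_iff)
  define X where "X = (\<lambda>\<omega> j. zcoset (G j) (\<Sum>i<Suc j. \<omega> i :: int ^ 'd))"
  have X: "X \<omega> \<in> odometer_points G" if "\<omega> \<in> space P" for \<omega>
  proof (rule odometer_pointsI)
    show "X \<omega> j = zcoset (G j) (\<Sum>i<Suc j. \<omega> i)" for j by (simp add: X_def)
    show "(\<Sum>i<Suc (Suc j). \<omega> i) - (\<Sum>i<Suc j. \<omega> i) \<in> G j" for j
      using D_K[of "\<omega> (Suc j)" "Suc j"] that by (simp add: spP K_Suc)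
  qed
  define w where "w j = (\<Prod>i<Suc j. ennreal (1 / card (D i)))" for j
  have cyl: "X -` cylinder j v \<inter> space P \<in> sets P \<and> emeasure P (X -` cylinder j v \<inter> space P) = w j" for j v
  proof -
    obtain a where a: "\<forall>i<Suc j. a i \<in> D i" "v - (\<Sum>i<Suc j. a i) \<in> K (Suc j)"
      and uniq: "\<And>\<omega>. (\<forall>i. \<omega> i \<in> D i) \<Longrightarrow> v - (\<Sum>i<Suc j. \<omega> i) \<in> K (Suc j) \<Longrightarrow> \<forall>i<Suc j. \<omega> i = a i"
      using digits[of "Suc j" v] by blast
    have "X \<omega> \<in> cylinder j v \<longleftrightarrow> (\<forall>i<Suc j. \<omega> i = a i)" if \<omega>: "\<omega> \<in> space P" for \<omega>
    proof -
      have "X \<omega> \<in> cylinder j v \<longleftrightarrow> v - (\<Sum>i<Suc j. \<omega> i) \<in> K (Suc j)"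
        using X[OF \<omega>] G_zcoset_eq[of j v] unfolding cylinder_def X_def K_Suc by auto
      also have "\<dots> \<longleftrightarrow> (\<forall>i<Suc j. \<omega> i = a i)"
      proof
        assume "\<forall>i<Suc j. \<omega> i = a i"
        then have "(\<Sum>i<Suc j. \<omega> i) = (\<Sum>i<Suc j. a i)" by (intro sum.cong) auto
        then show "v - (\<Sum>i<Suc j. \<omega> i) \<in> K (Suc j)" using a(2) by simp
      qed (use uniq \<omega> spP in blast)
      finally show ?thesis .
    qed
    then have eq: "X -` cylinder j v \<inter> space P = prod_emb UNIV U {..<Suc j} (\<Pi>\<^sub>E i\<in>{..<Suc j}. {a i})"
      using spP by (auto simp: prod_emb_def U_def P_def space_PiM PiE_iff space_uniform_count_measure)
    have sets: "{a i} \<in> sets (U i)" if "i \<in> {..<Suc j}" for i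
      using that a(1) by (auto simp: U_def sets_uniform_count_measure)
    have "emeasure (U i) {a i} = ennreal (1 / card (D i))" if "i \<in> {..<Suc j}" for i
      using that a(1) D_fin[of i] by (auto simp: U_def emeasure_uniform_count_measure)
    then show ?thesis
      unfolding eq unfolding P_def w_def using sets
      by (subst emeasure_PiM_emb) (auto intro!: sets_PiM_I prod.cong)
  qed
  define N where "N = sigma (odometer_points G) cylinders"
  have N: "space N = odometer_points G" "sets N = sigma_sets (odometer_points G) cylinders"
    using cylinders_Pow by (auto simp: N_def space_measure_of_conv sets_measure_of)
  have measX: "X \<in> measurable P N"
  proof (rule measurable_sigma_sets[OF N(2) cylinders_Pow])
    show "X \<in> space P \<rightarrow> odometer_points G" using X by blast
    show "X -` C \<inter> space P \<in> sets P" if "C \<in> cylinders" for C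
      using that cyl by (auto simp: cylinders_def)
  qed
  have "prob_space P" unfolding P_def by unfold_locales
  have "measure (distr P N X) (cylinder j v) = enn2real (w j)" for j v
    using cyl[of j v] measX cylinder_sets[OF N(2)] by (subst measure_distr) (auto simp: measure_def)
  then have "cylinder_uniform (distr P N X)"
    unfolding cylinder_uniform_def using N prob_space.prob_space_distr[OF \<open>prob_space P\<close> measX] by simp
  then show ?thesis ..
qed

lemma cylinder_uniform_odometer_measure: "cylinder_uniform (odometer_measure G)"
  unfolding odometer_measure_def haar_iff_cylinder_uniform
  using ex_cylinder_uniform cylinder_uniform_unique by (metis theI)

end

section \<open>Levels and descendants of stacking towers\<close>

locale stacking_rank_one =
  fixes M :: "'a measure"
    and T :: "int ^ 'd \<Rightarrow> 'a \<Rightarrow> 'a"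
    and F :: "nat \<Rightarrow> (int ^ 'd) set"
    and B :: "nat \<Rightarrow> 'a set"
  assumes action: "measure_preserving_action M T"
    and folner: "folner_sequence F"
    and zero_in_shape: "\<And>n. 0 \<in> F n"
    and rank_one: "rank_one_towers M T F B"
    and stacking: "stacking_towers M T F B"
begin

lemma prob_space_M: "prob_space M"
proof -
  have "prob_space M" if "finite (space M)" "space M \<noteq> {}" "M = uniform_count_measure (space M)"
    using prob_space_uniform_count_measure[OF that(1,2)] that(3) by simp
  then show ?thesis
    using action unfolding measure_preserving_action_def nonatomic_lebesgue_prob_space_def
      finite_uniform_prob_space_def by blast
qed

sublocale prob_space M by (rule prob_space_M)

lemma T_add: "x \<in> space M \<Longrightarrow> T (v + w) x = T v (T w x)"
  and T_zero: "x \<in> space M \<Longrightarrow> T 0 x = x"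
  and measurable_T [measurable]: "T v \<in> measurable M M"
  and distr_T: "distr M M (T v) = M"
  using action unfolding measure_preserving_action_def by blast+

lemma T_space: "x \<in> space M \<Longrightarrow> T v x \<in> space M"
  using measurable_T by (rule measurable_space)

lemma T_minus_cancel: "x \<in> space M \<Longrightarrow> T (- v) (T v x) = x" "x \<in> space M \<Longrightarrow> T v (T (- v) x) = x"
  using T_add[of x "- v" v] T_add[of x v "- v"] T_zero by simp_all

text \<open>Images under the action are preimages under its inverse, which makes them measurable.\<close>

lemma T_image_eq_vimage:
  assumes "A \<subseteq> space M"
  shows "T v ` A = T (- v) -` A \<inter> space M"
proof (intro equalityI subsetI)
  fix x assume "x \<in> T v ` A"
  then show "x \<in> T (- v) -` A \<inter> space M" using assms T_minus_cancel T_space by auto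
next
  fix x assume "x \<in> T (- v) -` A \<inter> space M"
  then have "T (- v) x \<in> A" "x = T v (T (- v) x)" using T_minus_cancel by auto
  then show "x \<in> T v ` A" by blast
qed

lemma T_image_sets: "A \<in> sets M \<Longrightarrow> T v ` A \<in> sets M"
  using T_image_eq_vimage[of A v] sets.sets_into_space[of A M] measurable_sets[OF measurable_T]
  by simp

lemma measure_T_image: "A \<in> sets M \<Longrightarrow> measure M (T v ` A) = measure M A"
  using T_image_eq_vimage[of A v] sets.sets_into_space[of A M]
    measure_distr[OF measurable_T[of "- v"], of A] by (simp add: distr_T)

lemma T_image_comp: "A \<subseteq> space M \<Longrightarrow> T v ` T w ` A = T (v + w) ` A"
  using T_add by (auto simp: image_image intro!: image_cong)

definition level :: "nat \<Rightarrow> int ^ 'd \<Rightarrow> 'a set" where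
  "level n v = T v ` B n"

abbreviation width :: "nat \<Rightarrow> real" where
  "width n \<equiv> measure M (B n)"

abbreviation tower :: "nat \<Rightarrow> 'a set" where
  "tower n \<equiv> (\<Union>v\<in>F n. level n v)"

lemma finite_shape: "finite (F n)"
  using folner by (simp add: folner_sequence_def)

lemma base_sets [measurable]: "B n \<in> sets M"
  and width_pos: "width n > 0"
  and disjoint_levels: "disjoint_family_on (level n) (F n)"
  using rank_one unfolding rank_one_towers_def is_tower_def level_def by blast+

lemma base_space: "B n \<subseteq> space M"
  using base_sets sets.sets_into_space by blast

lemma level_sets [measurable]: "level n v \<in> sets M"
  by (simp add: level_def T_image_sets)

lemma level_space: "level n v \<subseteq> space M"
  using level_sets sets.sets_into_space by blast

lemma measure_level: "measure M (level n v) = width n"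
  by (simp add: level_def measure_T_image)

lemma level_zero: "level n 0 = B n"
  using base_space[of n] T_zero by (auto simp: level_def image_iff subset_iff)

lemma level_unique: "x \<in> level n v \<Longrightarrow> x \<in> level n w \<Longrightarrow> v \<in> F n \<Longrightarrow> w \<in> F n \<Longrightarrow> v = w"
  using disjoint_levels[of n] unfolding disjoint_family_on_def by blast

lemma disjoint_levels_diff:
  assumes "V \<subseteq> F n"
  shows "disjoint_family_on (\<lambda>v. level n v - A) V"
  using disjoint_family_on_mono[OF assms disjoint_levels] unfolding disjoint_family_on_def by fast

lemma tower_sets [measurable]: "tower n \<in> sets M"
  using finite_shape by (intro sets.finite_UN) auto

lemma measure_Union_levels:
  "V \<subseteq> F n \<Longrightarrow> measure M (\<Union>v\<in>V. level n v) = card V * width n"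
  using finite_subset[OF _ finite_shape] disjoint_family_on_mono[OF _ disjoint_levels]
  by (subst finite_measure_finite_Union) (auto simp: measure_level)

lemma measure_Union_levels_le:
  "finite V \<Longrightarrow> measure M (\<Union>v\<in>V. level n v) \<le> card V * width n"
  using measure_UNION_le[of V "level n" M] by (simp add: measure_level)

definition tower_defect :: "nat \<Rightarrow> real" where
  "tower_defect n = 1 - card (F n) * width n"

lemma measure_tower: "measure M (tower n) = card (F n) * width n"
  by (rule measure_Union_levels) simp

lemma measure_off_tower: "measure M (space M - tower n) = tower_defect n"
  unfolding tower_defect_def using prob_compl[OF tower_sets] measure_tower by simp

lemma card_width_le_one: "card (F n) * width n \<le> 1"
  using prob_le_1[of "tower n"] measure_tower by simp

lemma approximation_by_levels:
  assumes "A \<in> sets M"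
  shows "\<exists>R. (\<forall>n. R n \<subseteq> F n) \<and> (\<lambda>n. measure M (sym_diff (\<Union>v\<in>R n. level n v) A)) \<longlonglongrightarrow> 0"
proof -
  have "\<forall>A\<in>sets M. \<exists>L. (\<forall>n. union_of_levels T (F n) (B n) (L n)) \<and>
      (\<lambda>n. measure M (sym_diff (L n) A)) \<longlonglongrightarrow> 0"
    using rank_one unfolding rank_one_towers_def by (rule conjunct2)
  from bspec[OF this assms] obtain L where L: "\<forall>n. union_of_levels T (F n) (B n) (L n)"
    and lim: "(\<lambda>n. measure M (sym_diff (L n) A)) \<longlonglongrightarrow> 0"
    by (elim exE conjE) (rule that)
  have "\<exists>R\<subseteq>F n. L n = (\<Union>v\<in>R. level n v)" for n
    using spec[OF L, of n] unfolding union_of_levels_def tower_levels_def level_def[symmetric]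
      subset_image_iff by auto
  then obtain R where "\<And>n. R n \<subseteq> F n" "\<And>n. L n = (\<Union>v\<in>R n. level n v)"
    by metis
  with lim show ?thesis by (intro exI[of _ R]) simp
qed

text \<open>The whole space is itself approximated by unions of levels.\<close>

lemma tower_defect_tendsto_zero: "tower_defect \<longlonglongrightarrow> 0"
proof -
  obtain R where R: "\<And>n. R n \<subseteq> F n"
    and lim: "(\<lambda>n. measure M (sym_diff (\<Union>v\<in>R n. level n v) (space M))) \<longlonglongrightarrow> 0"
    using approximation_by_levels[OF sets.top] by auto
  define L where "L n = (\<Union>v\<in>R n. level n v)" for n
  have L_tower: "L n \<subseteq> tower n" and L_sets: "L n \<in> sets M" for n
    using R[of n] finite_subset[OF R finite_shape] by (auto simp: L_def)
  have "tower_defect n \<le> measure M (sym_diff (L n) (space M))" for n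
    unfolding measure_off_tower[symmetric] using L_tower[of n] L_sets[of n]
    by (intro finite_measure_mono) auto
  moreover have "0 \<le> tower_defect n" for n
    unfolding measure_off_tower[symmetric] by simp
  ultimately show ?thesis
    by (intro tendsto_sandwich[OF _ _ tendsto_const lim]) (auto simp: L_def)
qed

lemma level_refines:
  assumes "m \<le> n" "v \<in> F m"
  shows "\<exists>J\<subseteq>F n. level m v = (\<Union>i\<in>J. level n i)"
  using assms(1)
proof (induction n rule: dec_induct)
  case base
  show ?case using assms(2) by (intro exI[of _ "{v}"]) auto
next
  case (step n)
  then obtain J where J: "J \<subseteq> F n" "level m v = (\<Union>i\<in>J. level n i)" by blast
  have "\<exists>K\<subseteq>F (Suc n). level n i = (\<Union>k\<in>K. level (Suc n) k)" if "i \<in> F n" for i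
  proof -
    have "\<forall>A\<in>tower_levels T (F n) (B n). union_of_levels T (F (Suc n)) (B (Suc n)) A"
      using stacking unfolding stacking_towers_def by simp
    then have "union_of_levels T (F (Suc n)) (B (Suc n)) (level n i)"
      using that by (simp add: tower_levels_def level_def)
    then show ?thesis
      unfolding union_of_levels_def tower_levels_def level_def[symmetric] subset_image_iff by auto
  qed
  then obtain K where K: "\<And>i. i \<in> F n \<Longrightarrow> K i \<subseteq> F (Suc n)"
    "\<And>i. i \<in> F n \<Longrightarrow> level n i = (\<Union>k\<in>K i. level (Suc n) k)"
    by metis
  have "level m v = (\<Union>i\<in>J. \<Union>k\<in>K i. level (Suc n) k)"
    unfolding J(2) by (intro SUP_cong refl K(2)) (rule subsetD[OF J(1)])
  then have "level m v = (\<Union>k\<in>(\<Union>i\<in>J. K i). level (Suc n) k)" by simp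
  moreover have "(\<Union>i\<in>J. K i) \<subseteq> F (Suc n)" using J(1) K(1) by auto
  ultimately show ?case by (intro exI conjI)
qed

lemma level_nested:
  assumes "m \<le> n" "v \<in> F m" "i \<in> F n" "x \<in> level n i" "x \<in> level m v"
  shows "level n i \<subseteq> level m v"
proof -
  obtain J where J: "J \<subseteq> F n" "level m v = (\<Union>i\<in>J. level n i)"
    using level_refines[OF assms(1,2)] by auto
  then obtain k where "k \<in> J" "x \<in> level n k" using assms(5) by auto
  then have "i = k" using level_unique[of x n i k] assms(3,4) J(1) by auto
  then show ?thesis using \<open>k \<in> J\<close> J by auto
qed

abbreviation desc :: "nat \<Rightarrow> nat \<Rightarrow> (int ^ 'd) set" where
  "desc m n \<equiv> descendants T F B m n"

lemma desc_subset: "desc m n \<subseteq> F n"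
  by (auto simp: descendants_def)

lemma finite_desc: "finite (desc m n)"
  using desc_subset finite_shape by (rule finite_subset)

text \<open>\<open>B m\<close> is the level of \<open>0 \<in> F m\<close>, and therefore a union of later levels.\<close>

lemma base_eq_Union_desc:
  assumes "m \<le> n"
  shows "B m = (\<Union>i\<in>desc m n. level n i)"
proof -
  obtain J where J: "J \<subseteq> F n" "B m = (\<Union>i\<in>J. level n i)"
    using level_refines[OF assms zero_in_shape] level_zero[of m] by auto
  have desc: "i \<in> desc m n \<longleftrightarrow> i \<in> F n \<and> level n i \<subseteq> B m" for i
    by (simp add: descendants_def level_def)
  show ?thesis
  proof (rule equalityI)
    have "J \<subseteq> desc m n" using J desc by blast
    then show "B m \<subseteq> (\<Union>i\<in>desc m n. level n i)" using J(2) by blast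
  qed (use desc in blast)
qed

lemma width_eq_card_desc: "m \<le> n \<Longrightarrow> width m = card (desc m n) * width n"
  using base_eq_Union_desc[of m n] measure_Union_levels[of "desc m n" n]
  by (auto simp: descendants_def)

lemma card_desc_pos: "m \<le> n \<Longrightarrow> card (desc m n) > 0"
  using width_eq_card_desc[of m n] width_pos[of m] by (cases "card (desc m n)") auto

section \<open>From periodic sets to concentrated descendants\<close>

text \<open>The levels of a union \<open>L\<close> close to \<open>A\<close> lie inside \<open>A\<close> on average. If each of them had a
  proportion of more than \<open>\<delta>\<close> outside \<open>A\<close>, the approximation error \<open>s\<close> would satisfy
  \<open>s \<ge> \<delta> \<mu>(L) \<ge> \<delta> (\<mu>(A) - s)\<close>, which fails once \<open>s < \<delta> \<mu>(A) / (1 + \<delta>)\<close>.\<close>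

lemma level_mostly_inside:
  assumes A: "A \<in> sets M" "measure M A > 0" and \<delta>: "\<delta> > 0"
  shows "\<exists>N. \<forall>m\<ge>N. \<exists>v\<in>F m. measure M (level m v - A) \<le> \<delta> * width m"
proof -
  obtain R where R: "\<And>n. R n \<subseteq> F n"
    and lim': "(\<lambda>n. measure M (sym_diff (\<Union>v\<in>R n. level n v) A)) \<longlonglongrightarrow> 0"
    using approximation_by_levels[OF A(1)] by auto
  define L where "L n = (\<Union>v\<in>R n. level n v)" for n
  have lim: "(\<lambda>n. measure M (sym_diff (L n) A)) \<longlonglongrightarrow> 0"
    using lim' by (simp add: L_def)
  have "\<delta> * measure M A / (1 + \<delta>) > 0" using A \<delta> by simp
  then obtain N where N: "\<And>m. m \<ge> N \<Longrightarrow> measure M (sym_diff (L m) A) < \<delta> * measure M A / (1 + \<delta>)"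
    using order_tendstoD(2)[OF lim] unfolding eventually_sequentially by blast
  have "\<exists>v\<in>F m. measure M (level m v - A) \<le> \<delta> * width m" if "m \<ge> N" for m
  proof (rule ccontr)
    assume "\<not> ?thesis"
    then have big: "\<And>v. v \<in> F m \<Longrightarrow> \<delta> * width m < measure M (level m v - A)" by force
    note R = R[of m] L_def[of m]
    have fin: "finite (R m)" using R finite_subset[OF _ finite_shape] by blast
    then have Lm [measurable]: "L m \<in> sets M" using R by auto
    let ?s = "measure M (sym_diff (L m) A)"
    have "card (R m) * (\<delta> * width m) \<le> (\<Sum>v\<in>R m. measure M (level m v - A))"
      using sum_mono[of "R m" "\<lambda>_. \<delta> * width m" "\<lambda>v. measure M (level m v - A)"] big R
      by (auto simp: less_imp_le subset_iff)
    also have "\<dots> = measure M (\<Union>v\<in>R m. level m v - A)"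
      using A fin disjoint_levels_diff[OF R(1)]
      by (intro finite_measure_finite_Union[symmetric]) auto
    also have "\<dots> \<le> ?s"
      using A R Lm by (intro finite_measure_mono) auto
    finally have 1: "\<delta> * measure M (L m) \<le> ?s"
      using measure_Union_levels[OF R(1)] R(2) by (simp add: algebra_simps)
    have "measure M A \<le> measure M (L m \<union> sym_diff (L m) A)"
      using A by (intro finite_measure_mono) auto
    also have "\<dots> \<le> measure M (L m) + ?s"
      using A by (intro measure_Un_le) auto
    finally have "\<delta> * (measure M A - ?s) \<le> \<delta> * measure M (L m)" using \<delta> by simp
    with 1 have "\<delta> * measure M A \<le> ?s * (1 + \<delta>)" by (simp add: algebra_simps)
    moreover have "?s * (1 + \<delta>) < \<delta> * measure M A"
      using N[OF that] \<delta> by (simp add: field_simps)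
    ultimately show False by simp
  qed
  then show ?thesis by blast
qed

text \<open>Both \<open>B m\<close> and \<open>B n\<close> lie in a translate of \<open>A\<close>, up to a proportion \<open>\<delta>\<close>. Those translates
  determine the class \<open>g\<close>. The level of a descendant \<open>i\<close> with \<open>i - g \<notin> H\<close> lies mostly in a
  translate almost disjoint from that of \<open>B m\<close>, so a proportion \<open>1 - \<delta>\<close> of it is in the part of
  \<open>B m\<close> that has measure at most \<open>\<delta> \<mu>(B m)\<close>. Comparing measures bounds the proportion of these
  descendants by \<open>\<delta> / (1 - \<delta>)\<close>.\<close>

lemma desc_concentrated:
  assumes A: "A \<in> sets M" "measure M A > 0"
    and periodic: "\<And>u. u \<notin> H \<Longrightarrow> measure M (A \<inter> T u ` A) = 0"
    and \<epsilon>: "\<epsilon> > 0"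
  shows "\<exists>N. \<forall>m n. N \<le> m \<and> m \<le> n \<longrightarrow>
    (\<exists>g. real (card {i \<in> desc m n. i - g \<notin> H}) / real (card (desc m n)) < \<epsilon>)"
proof -
  define \<delta> where "\<delta> = \<epsilon> / (2 * (1 + \<epsilon>))"
  have "\<delta> * (1 + \<epsilon>) = \<epsilon> / 2" using \<epsilon> unfolding \<delta>_def by (simp add: divide_simps)
  then have "\<delta> < \<epsilon> * (1 - \<delta>)" using \<epsilon> by (simp add: algebra_simps)
  moreover have "\<delta> > 0" using \<epsilon> by (simp add: \<delta>_def)
  moreover from calculation have "1 - \<delta> > 0"
    using zero_less_mult_pos[OF order_less_trans \<epsilon>] by blast
  ultimately have \<delta>: "\<delta> > 0" "\<delta> < \<epsilon> * (1 - \<delta>)" "\<delta> < 1" by simp_all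
  obtain N where N: "\<And>m. m \<ge> N \<Longrightarrow> \<exists>v\<in>F m. measure M (level m v - A) \<le> \<delta> * width m"
    using level_mostly_inside[OF A \<delta>(1)] by blast
  have "\<exists>g. real (card {i \<in> desc m n. i - g \<notin> H}) / real (card (desc m n)) < \<epsilon>"
    if mn: "N \<le> m" "m \<le> n" for m n
  proof -
    obtain v where v: "v \<in> F m" "measure M (level m v - A) \<le> \<delta> * width m"
      using N mn by blast
    obtain w where w: "w \<in> F n" "measure M (level n w - A) \<le> \<delta> * width n"
      using N[of n] mn by auto
    \<comment> \<open>The translate of \<open>A\<close> that carries \<open>B m\<close>; that of \<open>B n\<close> is \<open>T (- w) ` A\<close>, and hence
      \<open>T (i - w) ` A\<close> carries \<open>level n i\<close>.\<close>
    define A' where "A' = T (- v) ` A"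
    define bad where "bad = {i \<in> desc m n. i - (w - v) \<notin> H}"
    have A_space: "A \<subseteq> space M" using A sets.sets_into_space by blast
    have A': "A' \<in> sets M" unfolding A'_def using A T_image_sets by blast
    have "B m - A' \<subseteq> T (- v) ` (level m v - A)"
    proof
      fix x assume x: "x \<in> B m - A'"
      then have "x = T (- v) (T v x)" using base_space[of m] T_minus_cancel by auto
      moreover from this have "T v x \<notin> A" using x unfolding A'_def by auto
      moreover have "T v x \<in> level m v" using x by (simp add: level_def)
      ultimately show "x \<in> T (- v) ` (level m v - A)" by blast
    qed
    then have "measure M (B m - A') \<le> measure M (T (- v) ` (level m v - A))"
      using A T_image_sets by (intro finite_measure_mono) auto
    also have "\<dots> \<le> \<delta> * width m"
      using v(2) A by (simp add: measure_T_image)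
    finally have base: "measure M (B m - A') \<le> \<delta> * width m" .
    have each: "(1 - \<delta>) * width n \<le> measure M (level n i - A')" if i: "i \<in> bad" for i
    proof -
      have null: "measure M (T (i - w) ` A \<inter> A') = 0"
      proof -
        have "T (i - w) ` A \<inter> A' \<subseteq> T (- v) ` (A \<inter> T (i - (w - v)) ` A)"
        proof
          fix x assume "x \<in> T (i - w) ` A \<inter> A'"
          then obtain y z where x: "y \<in> A" "x = T (i - w) y" "z \<in> A" "x = T (- v) z"
            unfolding A'_def by auto
          have "z = T v (T (- v) z)" using T_minus_cancel(2)[of z v] x(3) A_space by auto
          also have "\<dots> = T v (T (i - w) y)" using x(2,4) by simp
          also have "\<dots> = T (i - (w - v)) y"
            using T_add[of y v "i - w"] x A_space by (auto simp: algebra_simps)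
          finally have "z \<in> A \<inter> T (i - (w - v)) ` A" using x(1,3) by blast
          then show "x \<in> T (- v) ` (A \<inter> T (i - (w - v)) ` A)" unfolding x(4) by (rule imageI)
        qed
        then have "measure M (T (i - w) ` A \<inter> A') \<le> measure M (T (- v) ` (A \<inter> T (i - (w - v)) ` A))"
          using A T_image_sets by (intro finite_measure_mono) auto
        also have "\<dots> = 0"
          using periodic[of "i - (w - v)"] i A T_image_sets
          by (subst measure_T_image) (auto simp: bad_def)
        finally show ?thesis by (simp add: measure_le_0_iff)
      qed
      have "level n i \<subseteq> (level n i - A') \<union> (T (i - w) ` (level n w - A) \<union> (T (i - w) ` A \<inter> A'))"
      proof
        fix x assume x: "x \<in> level n i"
        then obtain b where b: "b \<in> B n" "x = T i b" unfolding level_def by blast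
        then have "x = T (i - w) (T w b)"
          using T_add[of b "i - w" w] base_space[of n] by auto
        then show "x \<in> (level n i - A') \<union> (T (i - w) ` (level n w - A) \<union> (T (i - w) ` A \<inter> A'))"
          using x b unfolding level_def by blast
      qed
      then have "width n \<le> measure M ((level n i - A') \<union> (T (i - w) ` (level n w - A) \<union> (T (i - w) ` A \<inter> A')))"
        unfolding measure_level[of n i, symmetric] using A A' T_image_sets by (intro finite_measure_mono) auto
      also have "\<dots> \<le> measure M (level n i - A') + (measure M (T (i - w) ` (level n w - A)) + measure M (T (i - w) ` A \<inter> A'))"
        using A A' T_image_sets
        by (intro order_trans[OF measure_Un_le] add_left_mono measure_Un_le) auto
      also have "\<dots> \<le> measure M (level n i - A') + \<delta> * width n"
        using w(2) null A by (simp add: measure_T_image)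
      finally show ?thesis by (simp add: algebra_simps)
    qed
    have bad: "finite bad" "bad \<subseteq> desc m n" "bad \<subseteq> F n"
      using finite_desc desc_subset[of m n] by (auto simp: bad_def)
    have "card bad * ((1 - \<delta>) * width n) \<le> (\<Sum>i\<in>bad. measure M (level n i - A'))"
      using sum_mono[of bad "\<lambda>_. (1 - \<delta>) * width n" "\<lambda>i. measure M (level n i - A')"] each by simp
    also have "\<dots> = measure M (\<Union>i\<in>bad. level n i - A')"
      using A' bad(1) disjoint_levels_diff[OF bad(3)]
      by (intro finite_measure_finite_Union[symmetric]) auto
    also have "\<dots> \<le> measure M (B m - A')"
      using A' bad base_eq_Union_desc[OF mn(2)] by (intro finite_measure_mono) auto
    also have "\<dots> \<le> \<delta> * (card (desc m n) * width n)"
      using base width_eq_card_desc[OF mn(2)] by simp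
    finally have "(card bad * (1 - \<delta>)) * width n \<le> (\<delta> * card (desc m n)) * width n"
      by (simp add: algebra_simps)
    then have "card bad * (1 - \<delta>) \<le> \<delta> * card (desc m n)"
      using width_pos[of n] by (simp only: mult_le_cancel_right_pos)
    also have "\<dots> < (\<epsilon> * (1 - \<delta>)) * card (desc m n)"
      using \<delta>(2) card_desc_pos[OF mn(2)] by (intro mult_strict_right_mono) auto
    finally have "card bad * (1 - \<delta>) < (\<epsilon> * card (desc m n)) * (1 - \<delta>)"
      by (simp add: algebra_simps)
    then have "card bad < \<epsilon> * card (desc m n)"
      using \<delta>(3) by (simp only: mult_less_cancel_right_pos diff_gt_0_iff_gt)
    then have "real (card bad) / real (card (desc m n)) < \<epsilon>"
      using card_desc_pos[OF mn(2)] by (simp add: field_simps)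
    then show ?thesis unfolding bad_def by blast
  qed
  then show ?thesis by blast
qed

section \<open>Addresses in the towers\<close>

definition address :: "nat \<Rightarrow> 'a \<Rightarrow> int ^ 'd" where
  "address n x = (if x \<in> tower n then THE v. v \<in> F n \<and> x \<in> level n v else 0)"

lemma address_eq:
  assumes "v \<in> F n" "x \<in> level n v"
  shows "address n x = v"
proof -
  have "(THE v. v \<in> F n \<and> x \<in> level n v) = v"
  proof (rule the_equality)
    show "w = v" if "w \<in> F n \<and> x \<in> level n w" for w
      using level_unique[of x n w v] that assms by simp
  qed (simp add: assms)
  moreover have "x \<in> tower n" using assms by (rule UN_I)
  ultimately show ?thesis by (simp add: address_def)
qed

lemma measurable_address [measurable]: "address n \<in> measurable M (count_space UNIV)"
proof -
  have "address n -` {v} \<inter> space M =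
      (if v \<in> F n then level n v else {}) \<union> (if v = 0 then space M - tower n else {})" for v
  proof (intro equalityI subsetI)
    fix x assume x: "x \<in> address n -` {v} \<inter> space M"
    show "x \<in> (if v \<in> F n then level n v else {}) \<union> (if v = 0 then space M - tower n else {})"
    proof (cases "x \<in> tower n")
      case True
      then obtain w where "w \<in> F n" "x \<in> level n w" by blast
      with x show ?thesis using address_eq by auto
    qed (use x in \<open>auto simp: address_def\<close>)
  next
    fix x assume "x \<in> (if v \<in> F n then level n v else {}) \<union> (if v = 0 then space M - tower n else {})"
    then show "x \<in> address n -` {v} \<inter> space M"
      using level_space[of n v] address_eq[of v n x] by (auto simp: address_def split: if_splits)
  qed
  then show ?thesis
    by (subst measurable_count_space_eq_countable) auto
qed

text \<open>The measure of the levels that translation by \<open>w\<close> moves out of the shape.\<close>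

definition boundary :: "int ^ 'd \<Rightarrow> nat \<Rightarrow> real" where
  "boundary w n = card {v \<in> F n. v + w \<notin> F n} * width n"

lemma boundary_tendsto_zero: "boundary w \<longlonglongrightarrow> 0"
proof -
  have lim: "(\<lambda>n. real (card (sym_diff (F n) ((\<lambda>u. u + - w) ` F n))) / real (card (F n))) \<longlonglongrightarrow> 0"
    using folner unfolding folner_sequence_def by blast
  have "boundary w n \<le> real (card (sym_diff (F n) ((\<lambda>u. u + - w) ` F n))) / real (card (F n))" for n
  proof -
    have pos: "real (card (F n)) > 0"
      using finite_shape zero_in_shape by (auto simp: card_gt_0_iff)
    have "v \<notin> (\<lambda>u. u + - w) ` F n" if "v + w \<notin> F n" for v
      using that by (auto simp: algebra_simps)
    then have "{v \<in> F n. v + w \<notin> F n} \<subseteq> sym_diff (F n) ((\<lambda>u. u + - w) ` F n)" by blast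
    then have "card {v \<in> F n. v + w \<notin> F n} \<le> card (sym_diff (F n) ((\<lambda>u. u + - w) ` F n))"
      using finite_shape by (intro card_mono) auto
    moreover have "width n \<le> 1 / card (F n)"
      using card_width_le_one[of n] pos by (simp add: field_simps)
    ultimately have "boundary w n \<le> real (card (sym_diff (F n) ((\<lambda>u. u + - w) ` F n))) * (1 / card (F n))"
      unfolding boundary_def by (intro mult_mono) auto
    then show ?thesis by simp
  qed
  moreover have "0 \<le> boundary w n" for n by (simp add: boundary_def)
  ultimately show ?thesis
    by (intro tendsto_sandwich[OF _ _ tendsto_const lim]) auto
qed

text \<open>Moving \<open>x\<close> by \<open>T w\<close> can change its address by something other than \<open>w\<close> only if \<open>x\<close> is off the
  tower or in a level that \<open>w\<close> moves out of the shape.\<close>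

lemma address_equivariant_in_measure:
  "(\<lambda>n. measure M {x \<in> space M. address n (T w x) \<noteq> address n x + w}) \<longlonglongrightarrow> 0"
proof -
  have le: "measure M {x \<in> space M. address n (T w x) \<noteq> address n x + w} \<le> tower_defect n + boundary w n" for n
  proof -
    let ?V = "{v \<in> F n. v + w \<notin> F n}"
    have "{x \<in> space M. address n (T w x) \<noteq> address n x + w} \<subseteq> (space M - tower n) \<union> (\<Union>v\<in>?V. level n v)"
    proof
      fix x assume x: "x \<in> {x \<in> space M. address n (T w x) \<noteq> address n x + w}"
      show "x \<in> (space M - tower n) \<union> (\<Union>v\<in>?V. level n v)"
      proof (cases "x \<in> tower n")
        case True
        then obtain v where v: "v \<in> F n" "x \<in> level n v" by blast
        have "T w x \<in> T w ` level n v" using v(2) by blast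
        then have "T w x \<in> level n (v + w)"
          using T_image_comp[OF base_space, of w v] by (simp add: level_def add.commute)
        then have "v + w \<notin> F n" using x v address_eq by auto
        with v show ?thesis by blast
      qed (use x in auto)
    qed
    then have "measure M {x \<in> space M. address n (T w x) \<noteq> address n x + w}
        \<le> measure M ((space M - tower n) \<union> (\<Union>v\<in>?V. level n v))"
      using finite_shape[of n] by (intro finite_measure_mono) auto
    also have "\<dots> \<le> measure M (space M - tower n) + measure M (\<Union>v\<in>?V. level n v)"
      using finite_shape[of n] by (intro measure_Un_le) auto
    also have "\<dots> \<le> tower_defect n + boundary w n"
      unfolding measure_off_tower boundary_def
      using measure_Union_levels_le[of ?V n] finite_shape[of n] by simp
    finally show ?thesis .
  qed
  have lim: "(\<lambda>n. tower_defect n + boundary w n) \<longlonglongrightarrow> 0"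
    using tendsto_add[OF tower_defect_tendsto_zero boundary_tendsto_zero[of w]] by simp
  show ?thesis
    by (rule tendsto_sandwich[OF _ _ tendsto_const lim]) (simp_all add: le)
qed

text \<open>Let \<open>x\<close> have addresses \<open>v\<close> and \<open>i\<close> in the towers \<open>m\<close> and \<open>n\<close>. By nesting \<open>T i (B n)\<close> lies in
  \<open>T v (B m)\<close>, so \<open>T (i - v) (B n)\<close> lies in \<open>B m\<close>. This makes \<open>i - v\<close> a descendant only if it
  belongs to \<open>F n\<close>; the failures are the boundary terms. The points for which \<open>i - v\<close> is one of the
  bad descendants have measure at most \<open>\<epsilon>\<close>, since for each \<open>v \<in> F m\<close> the bad descendants account
  for a proportion of at most \<open>\<epsilon>\<close> of the level of \<open>v\<close>.\<close>

lemma measure_address_jump: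
  fixes \<epsilon> :: real
  assumes mn: "m \<le> n"
    and conc: "real (card {i \<in> desc m n. i - g \<notin> H}) \<le> \<epsilon> * card (desc m n)" and \<epsilon>: "\<epsilon> \<ge> 0"
  shows "measure M {x \<in> space M. address n x - address m x - g \<notin> H}
      \<le> tower_defect m + (tower_defect n + ((\<Sum>v\<in>F m. boundary (- v) n) + \<epsilon>))"
proof -
  define bad where "bad = {i \<in> desc m n. i - g \<notin> H}"
  have fin_bad: "finite bad" using finite_desc by (simp add: bad_def)
  \<comment> \<open>\<open>W1\<close> covers the case \<open>i - v \<notin> F n\<close>, and \<open>W2\<close> the bad descendants.\<close>
  define W1 where "W1 = (\<Union>v\<in>F m. \<Union>i\<in>{i \<in> F n. i + - v \<notin> F n}. level n i)"
  define W2 where "W2 = (\<Union>v\<in>F m. \<Union>i\<in>bad. level n (v + i))"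
  have W_sets: "W1 \<in> sets M" "W2 \<in> sets M"
    using finite_shape fin_bad by (auto simp: W1_def W2_def)
  have W1: "measure M W1 \<le> (\<Sum>v\<in>F m. boundary (- v) n)"
  proof -
    have "measure M W1 \<le> (\<Sum>v\<in>F m. measure M (\<Union>i\<in>{i \<in> F n. i + - v \<notin> F n}. level n i))"
      unfolding W1_def using finite_shape by (intro measure_UNION_le) auto
    also have "\<dots> \<le> (\<Sum>v\<in>F m. boundary (- v) n)"
      unfolding boundary_def using finite_shape by (intro sum_mono measure_Union_levels_le) auto
    finally show ?thesis .
  qed
  have W2: "measure M W2 \<le> \<epsilon>"
  proof -
    have "measure M W2 \<le> (\<Sum>v\<in>F m. measure M (\<Union>i\<in>bad. level n (v + i)))"
      unfolding W2_def using finite_shape fin_bad by (intro measure_UNION_le) auto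
    also have "\<dots> \<le> (\<Sum>v\<in>F m. \<epsilon> * width m)"
    proof (rule sum_mono)
      fix v
      have "measure M (\<Union>i\<in>bad. level n (v + i)) \<le> card bad * width n"
        using measure_UNION_le[OF fin_bad, of "\<lambda>i. level n (v + i)" M] by (simp add: measure_level)
      also have "\<dots> \<le> (\<epsilon> * card (desc m n)) * width n"
        using conc width_pos[of n] by (intro mult_right_mono) (auto simp: bad_def)
      also have "\<dots> = \<epsilon> * width m"
        using width_eq_card_desc[OF mn] by simp
      finally show "measure M (\<Union>i\<in>bad. level n (v + i)) \<le> \<epsilon> * width m" .
    qed
    also have "\<dots> = \<epsilon> * (card (F m) * width m)" by simp
    also have "\<dots> \<le> \<epsilon> * 1"
      using card_width_le_one[of m] \<epsilon> by (rule mult_left_mono)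
    finally show ?thesis by simp
  qed
  have "{x \<in> space M. address n x - address m x - g \<notin> H}
      \<subseteq> (space M - tower m) \<union> ((space M - tower n) \<union> (W1 \<union> W2))"
  proof
    fix x assume x: "x \<in> {x \<in> space M. address n x - address m x - g \<notin> H}"
    show "x \<in> (space M - tower m) \<union> ((space M - tower n) \<union> (W1 \<union> W2))"
    proof (cases "x \<in> tower m \<and> x \<in> tower n")
      case True
      then obtain v i where v: "v \<in> F m" "x \<in> level m v" and i: "i \<in> F n" "x \<in> level n i" by blast
      have far: "i - v - g \<notin> H" using x address_eq[OF v] address_eq[OF i] by simp
      show ?thesis
      proof (cases "i + - v \<in> F n")
        case True
        have "T (- v) ` level n i \<subseteq> T (- v) ` level m v"
          using level_nested[OF mn v(1) i v(2)] by (rule image_mono)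
        then have "level n (i - v) \<subseteq> B m"
          using T_image_comp[OF base_space, of "- v" i n] T_image_comp[OF base_space, of "- v" v m]
            level_zero[of m] by (simp add: level_def)
        then have "i - v \<in> bad"
          using True far by (simp add: bad_def descendants_def level_def)
        moreover have "x \<in> level n (v + (i - v))" using i by simp
        ultimately show ?thesis unfolding W2_def using v(1) by blast
      next
        case False
        then show ?thesis unfolding W1_def using v i by blast
      qed
    qed (use x in auto)
  qed
  then have "measure M {x \<in> space M. address n x - address m x - g \<notin> H}
      \<le> measure M ((space M - tower m) \<union> ((space M - tower n) \<union> (W1 \<union> W2)))"
    using W_sets by (intro finite_measure_mono) auto
  also have "\<dots> \<le> measure M (space M - tower m) + (measure M (space M - tower n) + (measure M W1 + measure M W2))"
    using W_sets
    by (intro order_trans[OF measure_Un_le] add_left_mono) auto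
  also have "\<dots> \<le> tower_defect m + (tower_defect n + ((\<Sum>v\<in>F m. boundary (- v) n) + \<epsilon>))"
    unfolding measure_off_tower using W1 W2 by simp
  finally show ?thesis .
qed

lemma address_cauchy_in_measure:
  fixes \<epsilon> :: real
  assumes conc: "\<And>\<epsilon> :: real. \<epsilon> > 0 \<Longrightarrow> \<exists>N. \<forall>m n. N \<le> m \<and> m \<le> n \<longrightarrow>
      (\<exists>g. real (card {i \<in> desc m n. i - g \<notin> H}) / real (card (desc m n)) < \<epsilon>)"
    and \<epsilon>: "\<epsilon> > 0"
  shows "\<exists>N. \<forall>m\<ge>N. \<exists>N'. \<forall>n\<ge>N'. \<exists>g. measure M {x \<in> space M. address n x - address m x - g \<notin> H} < \<epsilon>"
proof -
  have \<epsilon>4: "\<epsilon> / 4 > 0" using \<epsilon> by simp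
  obtain N1 where N1: "\<And>m n. N1 \<le> m \<Longrightarrow> m \<le> n \<Longrightarrow>
      \<exists>g. real (card {i \<in> desc m n. i - g \<notin> H}) / real (card (desc m n)) < \<epsilon> / 4"
    using conc[OF \<epsilon>4] by blast
  obtain N2 where N2: "\<And>n. N2 \<le> n \<Longrightarrow> tower_defect n < \<epsilon> / 4"
    using order_tendstoD(2)[OF tower_defect_tendsto_zero \<epsilon>4] unfolding eventually_sequentially by blast
  have "\<exists>N'. \<forall>n\<ge>N'. \<exists>g. measure M {x \<in> space M. address n x - address m x - g \<notin> H} < \<epsilon>"
    if m: "m \<ge> max N1 N2" for m
  proof -
    have "(\<lambda>n. \<Sum>v\<in>F m. boundary (- v) n) \<longlonglongrightarrow> (\<Sum>v\<in>F m. 0)"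
      by (intro tendsto_sum boundary_tendsto_zero)
    then have lim: "(\<lambda>n. \<Sum>v\<in>F m. boundary (- v) n) \<longlonglongrightarrow> 0" by simp
    obtain N3 where N3: "\<And>n. N3 \<le> n \<Longrightarrow> (\<Sum>v\<in>F m. boundary (- v) n) < \<epsilon> / 4"
      using order_tendstoD(2)[OF lim \<epsilon>4] unfolding eventually_sequentially by blast
    have "\<exists>g. measure M {x \<in> space M. address n x - address m x - g \<notin> H} < \<epsilon>" if n: "n \<ge> max m N3" for n
    proof -
      obtain g where g: "real (card {i \<in> desc m n. i - g \<notin> H}) / real (card (desc m n)) < \<epsilon> / 4"
        using N1[of m n] m n by auto
      have "card {i \<in> desc m n. i - g \<notin> H} \<le> \<epsilon> / 4 * card (desc m n)"
        using g card_desc_pos[of m n] n by (simp add: field_simps)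
      then have "measure M {x \<in> space M. address n x - address m x - g \<notin> H}
          \<le> tower_defect m + (tower_defect n + ((\<Sum>v\<in>F m. boundary (- v) n) + \<epsilon> / 4))"
        using n \<epsilon> by (intro measure_address_jump) auto
      also have "\<dots> < \<epsilon>"
        using N2[of m] N2[of n] N3[of n] m n by simp
      finally show ?thesis by blast
    qed
    then show ?thesis by blast
  qed
  then show ?thesis by blast
qed

end

section \<open>Factor maps onto the odometer\<close>

locale stacking_rank_one_odometer =
  stacking_rank_one M T F B + zd_odometer G
  for M :: "'a measure" and T :: "int ^ 'd \<Rightarrow> 'a \<Rightarrow> 'a"
    and F :: "nat \<Rightarrow> (int ^ 'd) set" and B :: "nat \<Rightarrow> 'a set" and G :: "nat \<Rightarrow> (int ^ 'd) set"
begin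

lemma odometer_action_cylinder:
  assumes "x \<in> odometer_points G" "y \<in> odometer_points G" "y = odometer_action w x"
  shows "y \<in> cylinder j v \<longleftrightarrow> x \<in> cylinder j (v - w)"
proof -
  obtain u where u: "x j = zcoset (G j) u" using odometer_points_rep[OF assms(1)] by blast
  then have "y j = zcoset (G j) (u + w)"
    by (simp add: assms(3) odometer_action_def zcoset_shift)
  with u assms(1,2) show ?thesis
    by (simp add: cylinder_def G_zcoset_eq algebra_simps)
qed

lemma space_odometer_measure: "space (odometer_measure G) = odometer_points G"
  and sets_odometer_measure: "sets (odometer_measure G) = sigma_sets (odometer_points G) cylinders"
  and cylinder_sets_odometer: "cylinder j v \<in> sets (odometer_measure G)"
  using cylinder_uniform_space[OF cylinder_uniform_odometer_measure]
    cylinder_uniform_sets[OF cylinder_uniform_odometer_measure] cylinder_sets by simp_all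

text \<open>The set of points whose \<open>j\<close>-th coordinate is \<open>G j\<close> has measure one over the index of \<open>G j\<close>, and its
  translate by \<open>u\<close> consists of the points with coordinate \<open>u + G j\<close>.\<close>

lemma factor_imp_desc_concentrated:
  assumes factor: "factors_onto M T (odometer_measure G) odometer_action" and \<epsilon>: "\<epsilon> > 0"
  shows "\<exists>N. \<forall>m n. N \<le> m \<and> m \<le> n \<longrightarrow>
    (\<exists>g. real (card {i \<in> desc m n. i - g \<notin> G j}) / real (card (desc m n)) < \<epsilon>)"
proof -
  let ?N = "odometer_measure G"
  obtain \<phi> where \<phi>: "\<phi> \<in> measurable M ?N" and distr: "distr M ?N \<phi> = ?N"
    and equiv: "AE x in M. \<forall>v. \<phi> (T v x) = odometer_action v (\<phi> x)"
    using factor unfolding factors_onto_def by blast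
  have \<phi>_points: "\<phi> x \<in> odometer_points G" if "x \<in> space M" for x
    using measurable_space[OF \<phi> that] space_odometer_measure by simp
  define A where "A = \<phi> -` cylinder j 0 \<inter> space M"
  have A: "A \<in> sets M" unfolding A_def by (rule measurable_sets[OF \<phi> cylinder_sets_odometer])
  have "measure M A = measure (distr M ?N \<phi>) (cylinder j 0)"
    unfolding A_def by (rule measure_distr[OF \<phi> cylinder_sets_odometer, symmetric])
  also have "\<dots> = 1 / card (range (zcoset (G j)))"
    unfolding distr by (rule cylinder_uniform_measure[OF cylinder_uniform_odometer_measure])
  also have "\<dots> > 0"
    using finite_coset_range[of j] by (simp add: card_gt_0_iff)
  finally have pos: "measure M A > 0" .
  show ?thesis
  proof (rule desc_concentrated[OF A pos _ \<epsilon>])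
    fix u assume u: "u \<notin> G j"
    have "AE x in M. x \<notin> A \<inter> T u ` A"
      using equiv
    proof (rule AE_mp, intro AE_I2 impI notI)
      fix x assume x: "x \<in> space M" and eq: "\<forall>v. \<phi> (T v x) = odometer_action v (\<phi> x)"
        and mem: "x \<in> A \<inter> T u ` A"
      have "T (- u) x \<in> A" using mem T_minus_cancel(1) by (auto simp: A_def)
      then have "\<phi> (T (- u) x) \<in> cylinder j 0" by (simp add: A_def)
      then have "\<phi> x \<in> cylinder j u"
        using odometer_action_cylinder[OF \<phi>_points[OF x] \<phi>_points[OF T_space[OF x]], of "- u" "- u" j 0] eq
        by simp
      moreover have "\<phi> x \<in> cylinder j 0" using mem by (simp add: A_def)
      ultimately have "zcoset (G j) u = zcoset (G j) 0" by (simp add: cylinder_def)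
      then show False using u by (simp add: G_zcoset_eq)
    qed
    then show "measure M (A \<inter> T u ` A) = 0"
      using A T_image_sets by (subst prob_eq_0) auto
  qed
qed

lemma measurable_diff_count_space:
  fixes f g :: "'a \<Rightarrow> int ^ 'd"
  assumes f: "f \<in> measurable M (count_space UNIV)" and g: "g \<in> measurable M (count_space UNIV)"
  shows "(\<lambda>x. f x - g x) \<in> measurable M (count_space UNIV)"
proof (rule measurable_compose_countable[OF _ g])
  show "(\<lambda>x. f x - i) \<in> measurable M (count_space UNIV)" for i
    using f by (rule measurable_compose) simp
qed

text \<open>Since \<open>G\<close> is decreasing, increments of \<open>\<psi>\<close> that eventually lie in \<open>G l\<close> make the coset
  \<open>\<psi> l x + G j\<close> eventually constant for each \<open>j\<close>; the limits form a point of the odometer.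
  Convergence holds almost everywhere but equivariance of \<open>\<psi> l\<close> only in measure. This suffices,
  because at almost every point equivariance then holds for infinitely many \<open>l\<close>.\<close>

lemma factor_of_convergent_addresses:
  assumes meas: "\<And>l. \<psi> l \<in> measurable M (count_space UNIV)"
    and conv: "AE x in M. eventually (\<lambda>l. \<psi> (Suc l) x - \<psi> l x \<in> G l) sequentially"
    and equiv: "\<And>w. (\<lambda>l. measure M {x \<in> space M. \<psi> l (T w x) \<noteq> \<psi> l x + w}) \<longlonglongrightarrow> 0"
  shows "factors_onto M T (odometer_measure G) odometer_action"
proof -
  let ?N = "odometer_measure G"
  define settled where "settled x \<longleftrightarrow> eventually (\<lambda>l. \<psi> (Suc l) x - \<psi> l x \<in> G l) sequentially" for x
  \<comment> \<open>The limit coset, described as a set by membership. The second case is the identity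
    of the odometer, which keeps \<open>\<phi>\<close> in the odometer off the set of convergence.\<close>
  define \<phi> where "\<phi> x = (\<lambda>j. if settled x then {u. eventually (\<lambda>l. u - \<psi> l x \<in> G j) sequentially}
      else zcoset (G j) 0)" for x
  have limit: "\<exists>K. \<forall>l\<ge>K. \<phi> x j = zcoset (G j) (\<psi> l x)" if x: "settled x" for x j
  proof -
    obtain L where L: "\<And>l. l \<ge> L \<Longrightarrow> \<psi> (Suc l) x - \<psi> l x \<in> G l"
      using x unfolding settled_def eventually_sequentially by blast
    define K where "K = max L j"
    have diff: "\<psi> l x - \<psi> K x \<in> G j" if "l \<ge> K" for l
      using that
    proof (induction l rule: dec_induct)
      case base
      show ?case by (simp add: G_zero)
    next
      case (step l)
      have "\<psi> (Suc l) x - \<psi> l x \<in> G j"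
        using L[of l] G_antimono[of j l] step(1) by (auto simp: K_def)
      from G_add[OF this step.IH] show ?case by simp
    qed
    have "\<phi> x j = zcoset (G j) (\<psi> l x)" if l: "l \<ge> K" for l
    proof (rule Set.set_eqI)
      fix u
      have iff: "u - \<psi> k x \<in> G j \<longleftrightarrow> u - \<psi> K x \<in> G j" if "k \<ge> K" for k
        using G_zcoset_eq[of j] diff[OF that] mem_zcoset[of u "G j"] by metis
      have "u \<in> \<phi> x j \<longleftrightarrow> eventually (\<lambda>k. u - \<psi> k x \<in> G j) sequentially"
        using x by (simp add: \<phi>_def)
      also have "\<dots> \<longleftrightarrow> eventually (\<lambda>k. u - \<psi> K x \<in> G j) sequentially"
        by (rule eventually_cong[OF eventually_ge_at_top[of K]]) (rule iff)
      also have "\<dots> \<longleftrightarrow> u \<in> zcoset (G j) (\<psi> l x)"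
        by (simp add: mem_zcoset iff[OF l])
      finally show "u \<in> \<phi> x j \<longleftrightarrow> u \<in> zcoset (G j) (\<psi> l x)" .
    qed
    then show ?thesis by blast
  qed
  have \<phi>_points: "\<phi> x \<in> odometer_points G" for x
  proof (cases "settled x")
    case True
    have "\<phi> x j \<in> carrier (zd_group Mod G j) \<and> G j <#>\<^bsub>zd_group\<^esub> \<phi> x (Suc j) = \<phi> x j" for j
    proof -
      obtain K1 K2 where K1: "\<forall>l\<ge>K1. \<phi> x j = zcoset (G j) (\<psi> l x)"
        and K2: "\<forall>l\<ge>K2. \<phi> x (Suc j) = zcoset (G (Suc j)) (\<psi> l x)"
        using limit[OF True] by metis
      then have "\<phi> x j = zcoset (G j) (\<psi> (max K1 K2) x)"
        "\<phi> x (Suc j) = zcoset (G (Suc j)) (\<psi> (max K1 K2) x)" by simp_all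
      then show ?thesis
        using zcoset_coarsen[of j "Suc j"] by (simp add: carrier_zd_quotient)
    qed
    then show ?thesis by (simp add: odometer_points_def)
  next
    case False
    then show ?thesis
      by (intro odometer_pointsI[where u = "\<lambda>_. 0"]) (simp_all add: \<phi>_def G_zero)
  qed
  have set1: "{x \<in> space M. \<psi> (Suc l) x - \<psi> l x \<in> G l} \<in> sets M" for l
    using measurable_sets[OF measurable_diff_count_space[OF meas[of "Suc l"] meas[of l]], of "G l"]
    by (simp add: vimage_def Int_def conj_commute)
  have set2: "{x \<in> space M. \<psi> l x - v \<in> G j} \<in> sets M" for l v j
    using measurable_sets[OF measurable_diff_count_space[OF meas[of l], of "\<lambda>_. v"], of "G j"]
    by (simp add: vimage_def Int_def conj_commute)
  have settled_sets: "{x \<in> space M. settled x} \<in> sets M"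
    unfolding settled_def eventually_sequentially
    by (intro sets.sets_Collect_countable_Ex sets.sets_Collect_countable_All sets.sets_Collect_imp set1)
       simp
  have cyl_eq: "\<phi> -` cylinder j v \<inter> space M =
      {x \<in> space M. settled x \<and> (\<exists>K. \<forall>l\<ge>K. \<psi> l x - v \<in> G j)} \<union>
      {x \<in> space M. \<not> settled x \<and> - v \<in> G j}" for j v
  proof -
    have "\<phi> x \<in> cylinder j v \<longleftrightarrow> (\<exists>K. \<forall>l\<ge>K. \<psi> l x - v \<in> G j)" if x: "settled x" for x
    proof -
      obtain K where K: "\<forall>l\<ge>K. \<phi> x j = zcoset (G j) (\<psi> l x)" using limit[OF x] by blast
      have iff: "\<phi> x \<in> cylinder j v \<longleftrightarrow> \<psi> l x - v \<in> G j" if "l \<ge> K" for l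
        using K that \<phi>_points[of x] by (simp add: cylinder_def G_zcoset_eq)
      show ?thesis
      proof
        show "\<exists>K. \<forall>l\<ge>K. \<psi> l x - v \<in> G j" if "\<phi> x \<in> cylinder j v" using iff that by blast
        assume "\<exists>K. \<forall>l\<ge>K. \<psi> l x - v \<in> G j"
        then obtain K' where "\<forall>l\<ge>K'. \<psi> l x - v \<in> G j" by blast
        then show "\<phi> x \<in> cylinder j v" using iff[of "max K K'"] by simp
      qed
    qed
    moreover have "\<phi> x \<in> cylinder j v \<longleftrightarrow> - v \<in> G j" if "\<not> settled x" for x
      using that \<phi>_points[of x] G_zcoset_eq[of j 0 v] by (simp add: cylinder_def \<phi>_def)
    ultimately show ?thesis by blast
  qed
  have \<phi>_meas: "\<phi> \<in> measurable M ?N"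
  proof (rule measurable_sigma_sets[OF sets_odometer_measure cylinders_Pow])
    show "\<phi> \<in> space M \<rightarrow> odometer_points G" using \<phi>_points by simp
    fix C assume "C \<in> cylinders"
    then consider "C = {}" | j v where "C = cylinder j v" unfolding cylinders_def by blast
    then show "\<phi> -` C \<inter> space M \<in> sets M"
    proof cases
      case (2 j v)
      show ?thesis
        unfolding 2 cyl_eq
        by (intro sets.Un sets.sets_Collect_conj sets.sets_Collect_neg sets.sets_Collect_countable_Ex
            sets.sets_Collect_countable_All sets.sets_Collect_imp settled_sets set2 sets.sets_Collect_const)
    qed simp
  qed
  have equivariant: "AE x in M. \<phi> (T w x) = odometer_action w (\<phi> x)" for w
  proof -
    have settled: "AE x in M. settled x" using conv by (simp add: settled_def)
    then have settled_T: "AE x in M. settled (T w x)"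
      by (rule AE_distrD[OF measurable_T, of settled w, unfolded distr_T])
    \<comment> \<open>The points at which equivariance fails for all \<open>l \<ge> L\<close> lie in each of the failure sets with
      \<open>l \<ge> L\<close>, whose measures tend to \<open>0\<close>.\<close>
    have often: "AE x in M. \<exists>l\<ge>L. \<psi> l (T w x) = \<psi> l x + w" for L
    proof -
      let ?Z = "{x \<in> space M. \<forall>l. L \<le> l \<longrightarrow> \<psi> l (T w x) \<noteq> \<psi> l x + w}"
      have fail: "{x \<in> space M. \<psi> l (T w x) \<noteq> \<psi> l x + w} \<in> sets M" for l
      proof -
        have "(\<lambda>x. \<psi> l (T w x) - \<psi> l x) \<in> measurable M (count_space UNIV)"
          by (rule measurable_diff_count_space[OF measurable_compose[OF measurable_T meas] meas])
        from measurable_sets[OF this, of "- {w}"] show ?thesis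
          by (simp add: vimage_def Int_def conj_commute diff_eq_eq add.commute)
      qed
      have Z: "?Z \<in> sets M"
        by (intro sets.sets_Collect_countable_All sets.sets_Collect_imp fail sets.sets_Collect_const)
      have "measure M ?Z \<le> measure M {x \<in> space M. \<psi> l (T w x) \<noteq> \<psi> l x + w}" if "l \<ge> L" for l
        using that by (intro finite_measure_mono fail) blast
      then have "measure M ?Z \<le> 0"
        using equiv[of w] by (intro LIMSEQ_le_const[of _ 0]) blast+
      then have "measure M ?Z = 0" by (simp add: measure_le_0_iff)
      then have "AE x in M. x \<notin> ?Z" using prob_eq_0[OF Z] by simp
      then show ?thesis by (rule AE_mp) (intro AE_I2, blast)
    qed
    then have "AE x in M. \<forall>L. \<exists>l\<ge>L. \<psi> l (T w x) = \<psi> l x + w"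
      by (simp add: AE_all_countable)
    with settled settled_T show ?thesis
    proof eventually_elim
      case (elim x)
      show ?case
      proof
        fix j
        obtain K1 where K1: "\<forall>l\<ge>K1. \<phi> x j = zcoset (G j) (\<psi> l x)" using limit[OF elim(1)] by blast
        obtain K2 where K2: "\<forall>l\<ge>K2. \<phi> (T w x) j = zcoset (G j) (\<psi> l (T w x))"
          using limit[OF elim(2)] by blast
        obtain l where l: "l \<ge> max K1 K2" "\<psi> l (T w x) = \<psi> l x + w" using elim(3) by blast
        then have "\<phi> x j = zcoset (G j) (\<psi> l x)" "\<phi> (T w x) j = zcoset (G j) (\<psi> l x + w)"
          using K1[rule_format, of l] K2[rule_format, of l] by simp_all
        then show "\<phi> (T w x) j = odometer_action w (\<phi> x) j"
          by (simp add: odometer_action_def zcoset_shift)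
      qed
    qed
  qed
  have vimage_sets: "\<phi> -` cylinder j v \<inter> space M \<in> sets M" for j v
    by (rule measurable_sets[OF \<phi>_meas cylinder_sets_odometer])
  have "measure (distr M ?N \<phi>) (cylinder j v) = measure (distr M ?N \<phi>) (cylinder j u)" for j v u
  proof -
    let ?w = "u - v"
    have "measure M (\<phi> -` cylinder j u \<inter> space M) = measure (distr M M (T ?w)) (\<phi> -` cylinder j u \<inter> space M)"
      by (simp add: distr_T)
    also have "\<dots> = measure M (T ?w -` (\<phi> -` cylinder j u \<inter> space M) \<inter> space M)"
      by (rule measure_distr[OF measurable_T vimage_sets])
    also have "\<dots> = measure M (\<phi> -` cylinder j v \<inter> space M)"
    proof (rule measure_eq_AE)
      show "AE x in M. x \<in> T ?w -` (\<phi> -` cylinder j u \<inter> space M) \<inter> space M \<longleftrightarrow> x \<in> \<phi> -` cylinder j v \<inter> space M"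
        using equivariant[of ?w]
      proof (rule AE_mp, intro AE_I2 impI)
        fix x assume "x \<in> space M" "\<phi> (T ?w x) = odometer_action ?w (\<phi> x)"
        then show "x \<in> T ?w -` (\<phi> -` cylinder j u \<inter> space M) \<inter> space M \<longleftrightarrow> x \<in> \<phi> -` cylinder j v \<inter> space M"
          using odometer_action_cylinder[OF \<phi>_points \<phi>_points, of "T ?w x" ?w x j u] T_space[of x ?w] by simp
      qed
    qed (rule measurable_sets[OF measurable_T vimage_sets] vimage_sets)+
    finally show ?thesis
      by (simp add: measure_distr[OF \<phi>_meas cylinder_sets_odometer])
  qed
  then have "cylinder_uniform (distr M ?N \<phi>)"
    unfolding cylinder_uniform_def
    using space_odometer_measure sets_odometer_measure prob_space_distr[OF \<phi>_meas] by simp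
  then have "distr M ?N \<phi> = ?N"
    by (rule cylinder_uniform_unique[OF _ cylinder_uniform_odometer_measure])
  moreover have "AE x in M. \<forall>v. \<phi> (T v x) = odometer_action v (\<phi> x)"
    using equivariant by (simp add: AE_all_countable)
  ultimately show ?thesis
    unfolding factors_onto_def using \<phi>_meas by blast
qed

text \<open>At step \<open>l\<close> the subgroup \<open>G l\<close> and the error \<open>2\<^sup>-\<^sup>l\<close> are used, so that one subsequence of the
  towers serves all coordinates.\<close>

lemma desc_concentrated_imp_factor:
  assumes conc: "\<And>j \<epsilon>. \<epsilon> > 0 \<Longrightarrow> \<exists>N. \<forall>m n. N \<le> m \<and> m \<le> n \<longrightarrow>
    (\<exists>g. real (card {i \<in> desc m n. i - g \<notin> G j}) / real (card (desc m n)) < \<epsilon>)"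
  shows "factors_onto M T (odometer_measure G) odometer_action"
proof -
  define jump where "jump l m n g = {x \<in> space M. address n x - address m x - g \<notin> G l}" for l m n g
  \<comment> \<open>\<open>good l m\<close> says that tower \<open>m\<close> can be followed by any sufficiently late tower at step \<open>l\<close>.\<close>
  define good where "good l m \<longleftrightarrow> (\<exists>N'. \<forall>n\<ge>N'. \<exists>g. measure M (jump l m n g) < (1 / 2) ^ l)" for l m
  have good: "\<exists>N. \<forall>m\<ge>N. good l m" for l
    unfolding good_def jump_def by (rule address_cauchy_in_measure[OF conc]) simp_all
  have "\<exists>s. \<forall>l. good l (s l) \<and> (s l < s (Suc l) \<and> (\<exists>g. measure M (jump l (s l) (s (Suc l)) g) < (1 / 2) ^ l))"
  proof (rule dependent_nat_choice)
    show "\<exists>m. good 0 m" using good[of 0] by blast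
    fix m l assume "good l m"
    then obtain N' where N': "\<forall>n\<ge>N'. \<exists>g. measure M (jump l m n g) < (1 / 2) ^ l"
      unfolding good_def by blast
    obtain N where N: "\<forall>m\<ge>N. good (Suc l) m" using good by blast
    show "\<exists>n. good (Suc l) n \<and> (m < n \<and> (\<exists>g. measure M (jump l m n g) < (1 / 2) ^ l))"
      using N N' by (intro exI[of _ "max (Suc m) (max N N')"]) simp
  qed
  then obtain s where s: "\<And>l. s l < s (Suc l)"
    and "\<And>l. \<exists>g. measure M (jump l (s l) (s (Suc l)) g) < (1 / 2) ^ l" by blast
  then obtain g where g: "\<And>l. measure M (jump l (s l) (s (Suc l)) (g l)) < (1 / 2) ^ l" by metis
  define \<psi> where "\<psi> l x = address (s l) x - (\<Sum>i<l. g i)" for l x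
  have \<psi>_meas: "\<psi> l \<in> measurable M (count_space UNIV)" for l
    unfolding \<psi>_def by (rule measurable_diff_count_space) simp_all
  have \<psi>_diff: "\<psi> (Suc l) x - \<psi> l x = address (s (Suc l)) x - address (s l) x - g l" for l x
    by (simp add: \<psi>_def algebra_simps)
  show ?thesis
  proof (rule factor_of_convergent_addresses[OF \<psi>_meas])
    let ?A = "\<lambda>l. jump l (s l) (s (Suc l)) (g l)"
    have "?A l = (\<lambda>x. \<psi> (Suc l) x - \<psi> l x) -` (- G l) \<inter> space M" for l
      unfolding jump_def \<psi>_diff by auto
    then have "?A l \<in> sets M" for l
      using measurable_sets[OF measurable_diff_count_space[OF \<psi>_meas \<psi>_meas]] by simp
    moreover have "summable (\<lambda>l. measure M (?A l))"
      by (rule summable_comparison_test'[of "\<lambda>l. (1 / 2) ^ l" 0])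
         (use g in \<open>auto intro: less_imp_le\<close>)
    ultimately have "AE x in M. eventually (\<lambda>l. x \<in> space M - ?A l) sequentially"
      by (intro borel_cantelli_AE1) (simp_all add: emeasure_eq_measure)
    then show "AE x in M. eventually (\<lambda>l. \<psi> (Suc l) x - \<psi> l x \<in> G l) sequentially"
    proof eventually_elim
      case (elim x)
      then show ?case by (rule eventually_mono) (simp add: jump_def \<psi>_diff)
    qed
  next
    fix w
    have "strict_mono s" using s by (simp add: strict_mono_Suc_iff)
    from LIMSEQ_subseq_LIMSEQ[OF address_equivariant_in_measure[of w] this]
    have "(\<lambda>l. measure M {x \<in> space M. address (s l) (T w x) \<noteq> address (s l) x + w}) \<longlonglongrightarrow> 0"
      by (simp add: o_def)
    moreover have "\<psi> l (T w x) \<noteq> \<psi> l x + w \<longleftrightarrow> address (s l) (T w x) \<noteq> address (s l) x + w" for l x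
      by (simp add: \<psi>_def algebra_simps)
    ultimately show "(\<lambda>l. measure M {x \<in> space M. \<psi> l (T w x) \<noteq> \<psi> l x + w}) \<longlonglongrightarrow> 0"
      by simp
  qed
qed

end

theorem corollary4p2:
  fixes M :: "'a measure"
    and T :: "int ^ 'd \<Rightarrow> 'a \<Rightarrow> 'a"
    and F :: "nat \<Rightarrow> (int ^ 'd) set"
    and B :: "nat \<Rightarrow> 'a set"
    and G :: "nat \<Rightarrow> (int ^ 'd) set"
  assumes "measure_preserving_action M T"
    and "folner_rank_one M T"
    and "folner_sequence F"
    and "\<And>n. 0 \<in> F n"
    and "rank_one_towers M T F B"
    and "stacking_towers M T F B"
    and "decreasing_finite_index_subgroups G"
  shows "factors_onto M T (odometer_measure G) odometer_action \<longleftrightarrow>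
    (\<forall>j. \<forall>\<epsilon>>0. \<exists>N. \<forall>m n. N \<le> m \<and> m \<le> n \<longrightarrow>
       (\<exists>g. real (card {i \<in> descendants T F B m n. i - g \<notin> G j})
              / real (card (descendants T F B m n)) < \<epsilon>))"
proof -
  interpret stacking_rank_one_odometer M T F B G
    using assms by unfold_locales
  show ?thesis
  proof
    assume "factors_onto M T (odometer_measure G) odometer_action"
    then show "\<forall>j. \<forall>\<epsilon>>0. \<exists>N. \<forall>m n. N \<le> m \<and> m \<le> n \<longrightarrow>
       (\<exists>g. real (card {i \<in> desc m n. i - g \<notin> G j}) / real (card (desc m n)) < \<epsilon>)"
      by (intro allI impI factor_imp_desc_concentrated)
  next
    assume conc: "\<forall>j. \<forall>\<epsilon>>0. \<exists>N. \<forall>m n. N \<le> m \<and> m \<le> n \<longrightarrow>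
       (\<exists>g. real (card {i \<in> desc m n. i - g \<notin> G j}) / real (card (desc m n)) < \<epsilon>)"
    show "factors_onto M T (odometer_measure G) odometer_action"
      by (rule desc_concentrated_imp_factor, rule conc[rule_format])
  qed
qed

end
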